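(* Let $n\ge2$, let $\Omega\subset\mathbb{C}^n$ be a domain, let $\varphi$ be a smooth real-valued function on $\Omega$, and let $1\le q\le n$. Assume that $L^{(q)}_{e^{-\varphi}}(a,r,s,A)\le1$ for every $(a,r,s,A)\in\Omega\times\mathbb{R}_{>0}\times\mathbb{R}_{>0}\times\mathbf{U}(n)$ with $a+P^{(q)}_{r,s,A}\subset\Omega$. Then $\varphi$ is uniformly $(m-1)$-semipositive on $\Omega$, where $m=\min\{q,n-q\}$ when $1\le q\le n-1$ and $m=n$ when $q=n$.
   Context: $\mathbf{U}(n)$ is the unitary group of degree $n$, and $\mathbb{B}^{k}_s\subset\mathbb{C}^k$ is the open ball of radius $s$ centered at $0$ (with $\mathbb{B}^0_s=\{0\}$). For $r,s>0$, $A\in\mathbf{U}(n)$, put $P^{(q)}_{r,s,A}=A(\mathbb{B}^q_r\times\mathbb{B}^{n-q}_s)$ (so $P^{(n)}_{r,s,A}=\mathbb{B}^n_r$), with Lebesgue measure $|P^{(q)}_{r,s,A}|$. For $a\in\Omega$, $r,s>0$, $A\in\mathbf{U}(n)$ with $a+P^{(q)}_{r,s,A}\subset\Omega$, the $q$-$L^2$-extension index of the metric $e^{-\varphi}$ on the trivial line bundle is $$L^{(q)}_{e^{-\varphi}}(a,r,s,A)=\inf\left\{\frac{\int_{a+P^{(q)}_{r,s,A}}|\sigma|^2e^{-\varphi}}{|P^{(q)}_{r,s,A}|\,|\xi|^2e^{-\varphi(a)}}\ \middle|\ \sigma\text{ holomorphic on }a+P^{(q)}_{r,s,A},\ \int_{a+P^{(q)}_{r,s,A}}|\sigma|^2e^{-\varphi}<\infty,\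 \sigma(a)=\xi\right\},$$ which is independent of $\xi\in\mathbb{C}\setminus\{0\}$ (integrals are with respect to Lebesgue measure). A smooth function $\varphi$ is called uniformly $(m-1)$-semipositive if at every point of $\Omega$ the sum of any $m$ eigenvalues, counted with multiplicity, of $\sqrt{-1}\partial\bar\partial\varphi$ (i.e. of the Hermitian matrix $(\partial^2\varphi/\partial z_j\partial\bar z_k)_{j,k}$) is $\ge0$. *)

theory Defs
  imports "HOL-Analysis.Analysis" "HOL-Computational_Algebra.Computational_Algebra"
begin

text \<open>
  Complex \<open>n\<close>-space is \<open>complex ^ 'n\<close> with \<open>n = CARD('n)\<close>.  A linear order on the index
  type gives a meaning to ``the first \<open>q\<close> coordinates''; the numeral types provide such a
  type in every finite cardinality.
\<close>

section \<open>Functions of several complex variables\<close>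

definition holomorphic_Cn_on :: "(complex ^ 'n \<Rightarrow> complex) \<Rightarrow> (complex ^ 'n) set \<Rightarrow> bool" where
  "holomorphic_Cn_on f S \<longleftrightarrow>
     (\<forall>z\<in>S. \<exists>D. (f has_derivative D) (at z) \<and> (\<forall>c v. D (c *s v) = c * D v))"

text \<open>Differentiability classes, meant for open sets only.\<close>

fun Ck_on :: "nat \<Rightarrow> ('a::real_normed_vector \<Rightarrow> 'b::real_normed_vector) \<Rightarrow> 'a set \<Rightarrow> bool" where
  "Ck_on 0 f S \<longleftrightarrow> continuous_on S f"
| "Ck_on (Suc k) f S \<longleftrightarrow>
     (\<forall>x\<in>S. f differentiable (at x)) \<and>
     (\<forall>v. Ck_on k (\<lambda>x. frechet_derivative f (at x) v) S)"

definition smooth_on :: "('a::real_normed_vector \<Rightarrow> 'b::real_normed_vector) \<Rightarrow> 'a set \<Rightarrow> bool" where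
  "smooth_on f S \<longleftrightarrow> (\<forall>k. Ck_on k f S)"

text \<open>
  The Wirtinger derivatives \<open>\<partial>/\<partial>z\<^sub>j = (\<partial>/\<partial>x\<^sub>j - i \<partial>/\<partial>y\<^sub>j)/2\<close> and
  \<open>\<partial>/\<partial>\<bar>z\<^sub>j = (\<partial>/\<partial>x\<^sub>j + i \<partial>/\<partial>y\<^sub>j)/2\<close>, where \<open>z\<^sub>j = x\<^sub>j + i y\<^sub>j\<close>.
\<close>

definition dz :: "'n \<Rightarrow> (complex ^ 'n \<Rightarrow> complex) \<Rightarrow> complex ^ 'n \<Rightarrow> complex" where
  "dz j f z = (frechet_derivative f (at z) (axis j 1)
                 - \<i> * frechet_derivative f (at z) (axis j \<i>)) / 2"

definition dzbar :: "'n \<Rightarrow> (complex ^ 'n \<Rightarrow> complex) \<Rightarrow> complex ^ 'n \<Rightarrow> complex" where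
  "dzbar j f z = (frechet_derivative f (at z) (axis j 1)
                    + \<i> * frechet_derivative f (at z) (axis j \<i>)) / 2"

definition complex_hessian :: "(complex ^ 'n \<Rightarrow> real) \<Rightarrow> complex ^ 'n \<Rightarrow> complex ^ 'n ^ 'n" where
  "complex_hessian \<phi> z = (\<chi> j k. dz j (dzbar k (\<lambda>w. complex_of_real (\<phi> w))) z)"

section \<open>Matrices\<close>

definition unitary_matrix :: "complex ^ 'n ^ 'n \<Rightarrow> bool" where
  "unitary_matrix A \<longleftrightarrow>
     A ** (\<chi> i j. cnj (A $ j $ i)) = mat 1 \<and> (\<chi> i j. cnj (A $ j $ i)) ** A = mat 1"

definition char_polynomial :: "complex ^ 'n ^ 'n \<Rightarrow> complex poly" where
  "char_polynomial A = det (\<chi> i j. (if i = j then [:0, 1:] else 0) - [:A $ i $ j:])"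

definition eigenvalues :: "complex ^ 'n ^ 'n \<Rightarrow> complex multiset" where
  "eigenvalues A = proots (char_polynomial A)"

text \<open>
  Uniform \<open>p\<close>-semipositivity concerns sums of \<open>p + 1\<close> eigenvalues.  The eigenvalues are
  complex numbers here, so nonnegativity of a sum is membership in \<open>\<real>\<^sub>\<ge>\<^sub>0\<close>.
\<close>

definition uniformly_semipositive_on ::
    "nat \<Rightarrow> (complex ^ 'n \<Rightarrow> real) \<Rightarrow> (complex ^ 'n) set \<Rightarrow> bool" where
  "uniformly_semipositive_on p \<phi> \<Omega> \<longleftrightarrow>
     (\<forall>z\<in>\<Omega>. \<forall>M. M \<subseteq># eigenvalues (complex_hessian \<phi> z) \<and> size M = p + 1
        \<longrightarrow> \<Sum>\<^sub># M \<in> \<real>\<^sub>\<ge>\<^sub>0)"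

section \<open>The extension index\<close>

definition first_coords :: "nat \<Rightarrow> 'n::{finite,linorder} set" where
  "first_coords q = {i. card {j. j < i} < q}"

text \<open>
  The set \<open>A(B\<^sup>q\<^sub>r \<times> B\<^sup>n\<^sup>-\<^sup>q\<^sub>s)\<close>.  For \<open>q = n\<close> the second norm is that of
  an empty family, hence \<open>0\<close>, and the condition on it is void since \<open>s > 0\<close>.
\<close>

definition biball ::
    "nat \<Rightarrow> real \<Rightarrow> real \<Rightarrow> complex ^ 'n::{finite,linorder} ^ 'n::{finite,linorder}
       \<Rightarrow> (complex ^ 'n::{finite,linorder}) set" where
  "biball q r s A =
     (*v) A ` {z. L2_set (\<lambda>i. cmod (z $ i)) (first_coords q) < r \<and>
                  L2_set (\<lambda>i. cmod (z $ i)) (- first_coords q) < s}"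

definition weighted_L2 ::
    "(complex ^ 'n \<Rightarrow> real) \<Rightarrow> (complex ^ 'n) set \<Rightarrow> (complex ^ 'n \<Rightarrow> complex) \<Rightarrow> ennreal" where
  "weighted_L2 \<phi> X \<sigma> = (\<integral>\<^sup>+ z\<in>X. ennreal ((cmod (\<sigma> z))\<^sup>2 * exp (- \<phi> z)) \<partial>lborel)"

text \<open>
  The infimum is taken in \<open>ennreal\<close>, so it is \<open>\<infinity>\<close> when no admissible \<open>\<sigma>\<close> exists.
\<close>

definition L2_ext_index_at ::
    "complex \<Rightarrow> nat \<Rightarrow> (complex ^ 'n::{finite,linorder} \<Rightarrow> real)
       \<Rightarrow> complex ^ 'n::{finite,linorder} \<Rightarrow> real \<Rightarrow> real
       \<Rightarrow> complex ^ 'n::{finite,linorder} ^ 'n::{finite,linorder} \<Rightarrow> ennreal" where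
  "L2_ext_index_at \<xi> q \<phi> a r s A =
     Inf {weighted_L2 \<phi> ((+) a ` biball q r s A) \<sigma>
            / (emeasure lborel (biball q r s A) * ennreal ((cmod \<xi>)\<^sup>2 * exp (- \<phi> a))) |\<sigma>.
          holomorphic_Cn_on \<sigma> ((+) a ` biball q r s A) \<and>
          weighted_L2 \<phi> ((+) a ` biball q r s A) \<sigma> < \<infinity> \<and> \<sigma> a = \<xi>}"

text \<open>
  By \<open>L2_ext_index_at_eq\<close> below, any nonzero value may replace \<open>1\<close>.
\<close>

definition L2_ext_index ::
    "nat \<Rightarrow> (complex ^ 'n::{finite,linorder} \<Rightarrow> real)
       \<Rightarrow> complex ^ 'n::{finite,linorder} \<Rightarrow> real \<Rightarrow> real
       \<Rightarrow> complex ^ 'n::{finite,linorder} ^ 'n::{finite,linorder} \<Rightarrow> ennreal" where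
  "L2_ext_index = L2_ext_index_at 1"

lemma nn_integral_cmult_le:
  fixes c :: real
  shows "ennreal c * integral\<^sup>N M f \<le> (\<integral>\<^sup>+x. ennreal c * f x \<partial>M)"
proof -
  have "ennreal c * integral\<^sup>N M f
      = (SUP g\<in>{g. simple_function M g \<and> g \<le> f}. ennreal c * integral\<^sup>S M g)"
    unfolding nn_integral_def by (rule SUP_mult_left_ennreal)
  also have "\<dots> \<le> (\<integral>\<^sup>+x. ennreal c * f x \<partial>M)"
  proof (rule SUP_least)
    fix g assume "g \<in> {g. simple_function M g \<and> g \<le> f}"
    hence g: "simple_function M g" "g \<le> f" by auto
    have "ennreal c * integral\<^sup>S M g = (\<integral>\<^sup>Sx. ennreal c * g x \<partial>M)"
      using g(1) by simp
    also have "\<dots> = (\<integral>\<^sup>+x. ennreal c * g x \<partial>M)"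
      using g(1) by (intro nn_integral_eq_simple_integral[symmetric]) auto
    also have "\<dots> \<le> (\<integral>\<^sup>+x. ennreal c * f x \<partial>M)"
      using g(2) by (intro nn_integral_mono mult_left_mono) (auto simp: le_fun_def)
    finally show "ennreal c * integral\<^sup>S M g \<le> (\<integral>\<^sup>+x. ennreal c * f x \<partial>M)" .
  qed
  finally show ?thesis .
qed

lemma weighted_L2_scale:
  assumes "c \<noteq> 0"
  shows "weighted_L2 \<phi> X (\<lambda>z. c * \<sigma> z) = ennreal ((cmod c)\<^sup>2) * weighted_L2 \<phi> X \<sigma>"
proof -
  have le: "ennreal ((cmod d)\<^sup>2) * weighted_L2 \<phi> X \<tau> \<le> weighted_L2 \<phi> X (\<lambda>z. d * \<tau> z)" for d \<tau>
  proof -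
    have "ennreal ((cmod d)\<^sup>2) * weighted_L2 \<phi> X \<tau>
        \<le> (\<integral>\<^sup>+z. ennreal ((cmod d)\<^sup>2) *
              (ennreal ((cmod (\<tau> z))\<^sup>2 * exp (- \<phi> z)) * indicator X z) \<partial>lborel)"
      unfolding weighted_L2_def by (rule nn_integral_cmult_le)
    also have "\<dots> = weighted_L2 \<phi> X (\<lambda>z. d * \<tau> z)"
      unfolding weighted_L2_def
      by (intro nn_integral_cong)
         (auto simp: norm_mult power_mult_distrib ennreal_mult' [symmetric] mult_ac
               split: split_indicator)
    finally show ?thesis .
  qed
  have one: "ennreal ((cmod c)\<^sup>2) * ennreal ((cmod (inverse c))\<^sup>2) = 1"
    using assms by (simp add: ennreal_mult' [symmetric] norm_inverse power_inverse)
  have "weighted_L2 \<phi> X (\<lambda>z. c * \<sigma> z)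
      = ennreal ((cmod c)\<^sup>2) *
          (ennreal ((cmod (inverse c))\<^sup>2) * weighted_L2 \<phi> X (\<lambda>z. c * \<sigma> z))"
    by (simp add: mult.assoc [symmetric] one)
  also have "\<dots> \<le> ennreal ((cmod c)\<^sup>2) * weighted_L2 \<phi> X (\<lambda>z. inverse c * (c * \<sigma> z))"
    by (intro mult_left_mono le) auto
  also have "\<dots> = ennreal ((cmod c)\<^sup>2) * weighted_L2 \<phi> X \<sigma>"
    using assms by (simp add: mult.assoc [symmetric])
  finally show ?thesis using le[of c \<sigma>] by (intro antisym)
qed

lemma holomorphic_Cn_on_cmult:
  assumes "holomorphic_Cn_on f S"
  shows "holomorphic_Cn_on (\<lambda>z. c * f z) S"
  unfolding holomorphic_Cn_on_def
proof
  fix z assume "z \<in> S"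
  then obtain D where D: "(f has_derivative D) (at z)" "\<And>c v. D (c *s v) = c * D v"
    using assms unfolding holomorphic_Cn_on_def by blast
  have "((\<lambda>z. c * f z) has_derivative (\<lambda>v. c * D v)) (at z)"
    by (rule has_derivative_mult_right [OF D(1)])
  moreover have "c * D (d *s v) = d * (c * D v)" for d v
    using D(2) by simp
  ultimately show "\<exists>D. ((\<lambda>z. c * f z) has_derivative D) (at z) \<and> (\<forall>c v. D (c *s v) = c * D v)"
    by blast
qed

lemma ennreal_divide_cancel_left:
  assumes "0 < c"
  shows "(ennreal c * x) / (m * ennreal (c * b)) = x / (m * ennreal b)"
proof -
  have "m * ennreal (c * b) = (m * ennreal b) * ennreal c"
    by (subst ennreal_mult' [OF less_imp_le [OF assms]]) (simp add: mult_ac)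
  thus ?thesis
    using assms divide_mult_eq [of "ennreal c" x "m * ennreal b"] by (simp add: mult.commute)
qed

lemma L2_ext_index_at_eq:
  assumes "\<xi> \<noteq> 0"
  shows "L2_ext_index_at \<xi> q \<phi> a r s A = L2_ext_index q \<phi> a r s A"
proof -
  have le: "L2_ext_index_at \<eta> q \<phi> a r s A \<le> L2_ext_index_at \<zeta> q \<phi> a r s A"
    if nz: "\<eta> \<noteq> 0" "\<zeta> \<noteq> 0" for \<eta> \<zeta>
    unfolding L2_ext_index_at_def
  proof (rule Inf_superset_mono, safe)
    let ?P = "biball q r s A"
    let ?X = "(+) a ` ?P"
    fix \<sigma> assume \<sigma>: "holomorphic_Cn_on \<sigma> ?X" "weighted_L2 \<phi> ?X \<sigma> < \<infinity>" "\<zeta> = \<sigma> a"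
    define c where "c = \<eta> / \<zeta>"
    have c: "c \<noteq> 0" "\<eta> = c * \<zeta>" using nz by (auto simp: c_def)
    have w: "weighted_L2 \<phi> ?X (\<lambda>z. c * \<sigma> z) = ennreal ((cmod c)\<^sup>2) * weighted_L2 \<phi> ?X \<sigma>"
      using c(1) by (rule weighted_L2_scale)
    have b: "(cmod \<eta>)\<^sup>2 * exp (- \<phi> a) = (cmod c)\<^sup>2 * ((cmod \<zeta>)\<^sup>2 * exp (- \<phi> a))"
      by (simp add: c(2) norm_mult power_mult_distrib)
    have "weighted_L2 \<phi> ?X \<sigma> / (emeasure lborel ?P * ennreal ((cmod \<zeta>)\<^sup>2 * exp (- \<phi> a)))
        = weighted_L2 \<phi> ?X (\<lambda>z. c * \<sigma> z)
            / (emeasure lborel ?P * ennreal ((cmod \<eta>)\<^sup>2 * exp (- \<phi> a)))"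
      unfolding w b using c(1) by (subst ennreal_divide_cancel_left) auto
    moreover have "holomorphic_Cn_on (\<lambda>z. c * \<sigma> z) ?X"
      using \<sigma>(1) by (rule holomorphic_Cn_on_cmult)
    moreover have "weighted_L2 \<phi> ?X (\<lambda>z. c * \<sigma> z) < \<infinity>"
      unfolding w using \<sigma>(2) by (simp add: ennreal_mult_less_top)
    ultimately show "\<exists>\<tau>. weighted_L2 \<phi> ?X \<sigma>
            / (emeasure lborel ?P * ennreal ((cmod (\<sigma> a))\<^sup>2 * exp (- \<phi> a)))
        = weighted_L2 \<phi> ?X \<tau> / (emeasure lborel ?P * ennreal ((cmod \<eta>)\<^sup>2 * exp (- \<phi> a)))
        \<and> holomorphic_Cn_on \<tau> ?X \<and> weighted_L2 \<phi> ?X \<tau> < \<infinity> \<and> \<tau> a = \<eta>"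
      using c(2) \<sigma>(3) by (intro exI [of _ "\<lambda>z. c * \<sigma> z"]) simp
  qed
  show ?thesis
    unfolding L2_ext_index_def using assms by (intro antisym le) auto
qed

end

theory Submission
  imports Defs "HOL-Complex_Analysis.Cauchy_Integral_Formula"
begin

text \<open>
  Fix a point \<open>a\<close>.  Taylor's formula splits \<open>\<phi>\<close> near \<open>a\<close> as
  \<open>\<phi>(a + v) = \<phi>(a) + Re h(v) + S(v) + o(|v|\<^sup>2)\<close>, where \<open>h\<close> is a holomorphic polynomial with
  \<open>h(0) = 0\<close> and \<open>S\<close> is the Hermitian form of the complex Hessian at \<open>a\<close> (\<open>levi_expansion\<close>).

  An upper bound on the extension index is a lower bound on the mean of \<open>S\<close>.  Let \<open>\<sigma>\<close> be holomorphic
  on \<open>a + P\<close> with \<open>\<sigma>(a) = 1\<close>.  The inequality \<open>x\<^sup>2 + y\<^sup>2 \<ge> 2xy\<close> gives, pointwise,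
  \<open>|\<sigma>(a + v)|\<^sup>2 e\<^bsup>\<phi>(a) - \<phi>(a + v)\<^esup> \<ge> 2 Re (\<sigma>(a + v) e\<^bsup>-h(v)/2\<^esup>) - e\<^bsup>\<phi>(a + v) - \<phi>(a) - Re h(v)\<^esup>\<close>.
  The set \<open>P\<close> is stable under multiplication by scalars of modulus at most \<open>1\<close>, so the mean over
  \<open>P\<close> of the holomorphic function \<open>\<sigma>(a + v) e\<^bsup>-h(v)/2\<^esup>\<close> is its value \<open>1\<close> at the centre.  Hence the index is at
  least \<open>2\<close> minus the mean over \<open>P\<close> of \<open>e\<^bsup>\<phi>(a + v) - \<phi>(a) - Re h(v)\<^esup>\<close>.  For every \<open>\<epsilon> > 0\<close> this
  exponential is at most \<open>1 + S(v) + \<epsilon>|v|\<^sup>2\<close> near \<open>v = 0\<close>, and so an index at most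
  \<open>1\<close> forces the mean of \<open>S(v) + \<epsilon>|v|\<^sup>2\<close> over every small \<open>P\<close> to be nonnegative
  (\<open>weighted_L2_lower_bound\<close>, \<open>L2_ext_index_le_1_imp_mean\<close>).

  Now let \<open>A\<close> be a unitary matrix whose columns diagonalize \<open>S\<close>, with eigenvalues \<open>d\<^sub>i\<close> in an order
  of our choice.  The second moment of the \<open>i\<close>-th coordinate on \<open>B\<^sub>r \<times> B\<^sub>s\<close> is a common factor times
  \<open>r\<^sup>2 \<kappa>\<close> in the first block and \<open>s\<^sup>2 \<kappa>'\<close> in the second, with \<open>\<kappa>, \<kappa>' > 0\<close> independent of \<open>r\<close> and
  \<open>s\<close>.  So \<open>r\<^sup>2 \<kappa> \<Sigma> + s\<^sup>2 \<kappa>' \<Sigma>' \<ge> 0\<close> for all \<open>r, s > 0\<close>, where \<open>\<Sigma>\<close> and \<open>\<Sigma>'\<close> are the sums of the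
  eigenvalues placed in the two blocks.  Degenerating the bi-ball by \<open>s \<rightarrow> 0\<close> or by \<open>r \<rightarrow> 0\<close> shows
  \<open>\<Sigma> \<ge> 0\<close> and \<open>\<Sigma>' \<ge> 0\<close> (\<open>weighted_eigenvalue_sum_nonneg\<close>, \<open>block_sums_nonneg\<close>).  The blocks have
  \<open>q\<close> and \<open>n - q\<close> entries, so any \<open>m\<close> eigenvalues fill one of them.
\<close>

(* Here $ always means a vector component, not a power series coefficient. *)
unbundle no Formal_Power_Series.fps_syntax

section \<open>Invariance of Lebesgue measure under isometries\<close>

text \<open>
  By Vitali's covering theorem an open set is, up to a null set, a countable disjoint union of
  balls.  An isometry maps balls to balls of the same radius and null sets to null sets.
\<close>

lemma emeasure_vimage_orthogonal_transformation_open: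
  fixes f :: "'a::euclidean_space \<Rightarrow> 'a"
  assumes f: "orthogonal_transformation f" and U: "open U"
  shows "emeasure lborel (f -` U) = emeasure lborel U"
proof -
  define K where "K = {(x, r). ball x r \<subseteq> U}"
  obtain C where C: "countable C" "C \<subseteq> K"
     "pairwise (\<lambda>i j. disjnt (ball (fst i) (snd i)) (ball (fst j) (snd j))) C"
     "negligible (U - (\<Union>i \<in> C. ball (fst i) (snd i)))"
  proof (rule Vitali_covering_theorem_balls[of U K fst snd])
    fix x and d :: real assume "x \<in> U" "0 < d"
    then obtain e where e: "e > 0" "ball x e \<subseteq> U" using U by (meson open_contains_ball)
    show "\<exists>i. i \<in> K \<and> x \<in> ball (fst i) (snd i) \<and> snd i < d"
      using e \<open>0 < d\<close>
      by (intro exI[of _ "(x, min e (d/2))"]) (auto simp: K_def)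
  qed
  define B where "B = (\<lambda>i::'a \<times> real. ball (fst i) (snd i))"
  define N where "N = U - (\<Union>i\<in>C. B i)"
  define g where "g = inv f"
  have bij: "bij f" using f by (rule orthogonal_transformation_bij)
  have lin: "linear f" using f by (rule orthogonal_transformation_linear)
  have cont: "continuous_on UNIV f" using lin by (simp add: linear_continuous_on linear_conv_bounded_linear)
  have [measurable]: "f \<in> borel_measurable borel" using cont by (rule borel_measurable_continuous_onI)
  have g: "orthogonal_transformation g" unfolding g_def using f by (rule orthogonal_transformation_inv)
  have fg: "f (g x) = x" "g (f x) = x" for x
    unfolding g_def using bij by (simp_all add: bij_is_surj surj_f_inv_f bij_is_inj)
  have vim: "f -` X = g ` X" for X
  proof (intro set_eqI iffI)
    fix x assume "x \<in> f -` X" then show "x \<in> g ` X" using fg(2)[of x] by (metis imageI vimageD)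
  next
    fix x assume "x \<in> g ` X" then show "x \<in> f -` X" using fg(1) by auto
  qed
  have ball: "emeasure lborel (f -` B i) = emeasure lborel (B i)" for i
    unfolding vim B_def image_orthogonal_transformation_ball[OF g]
    by (cases "snd i \<ge> 0") (auto simp: emeasure_ball not_le ball_empty)
  have disj: "disjoint_family_on B C"
    using C(3) unfolding disjoint_family_on_def pairwise_def disjnt_def B_def by auto
  hence disj': "disjoint_family_on (\<lambda>i. f -` B i) C"
    unfolding disjoint_family_on_def by blast
  have [measurable]: "N \<in> sets borel" unfolding N_def B_def
    using U C(1) by (intro sets.Diff sets.countable_UN') auto
  have neg: "negligible N" using C(4) unfolding N_def B_def .
  have negv: "negligible (f -` N)"
    unfolding vim using neg
    by (intro negligible_differentiable_image_negligible linear_imp_differentiable_on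
              orthogonal_transformation_linear g) auto
  have fN: "f -` N \<in> sets borel" using measurable_sets[of f borel borel N] by simp
  have null: "X \<in> null_sets lborel" if "negligible X" "X \<in> sets borel" for X :: "'a set"
    using that by (simp add: negligible_iff_null_sets null_sets_completion_iff)
  have Bs: "B i \<in> sets lborel" "f -` B i \<in> sets lborel" for i
    using measurable_sets[of f borel borel "B i"] by (auto simp: B_def)
  have U_eq: "U = (\<Union>i\<in>C. B i) \<union> N"
    using C(2) unfolding N_def B_def K_def by fastforce
  have "emeasure lborel (f -` U) = emeasure lborel ((\<Union>i\<in>C. f -` B i) \<union> f -` N)"
    by (subst U_eq) (simp add: vimage_Un vimage_UN)
  also have "\<dots> = emeasure lborel (\<Union>i\<in>C. f -` B i)"
    using Bs C(1) null[OF negv fN] by (intro emeasure_Un_null_set sets.countable_UN') auto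
  also have "\<dots> = (\<integral>\<^sup>+i. emeasure lborel (f -` B i) \<partial>count_space C)"
    using Bs C(1) disj' by (intro emeasure_UN_countable) auto
  also have "\<dots> = (\<integral>\<^sup>+i. emeasure lborel (B i) \<partial>count_space C)"
    by (simp add: ball)
  also have "\<dots> = emeasure lborel (\<Union>i\<in>C. B i)"
    using Bs C(1) disj by (intro emeasure_UN_countable[symmetric]) auto
  also have "\<dots> = emeasure lborel ((\<Union>i\<in>C. B i) \<union> N)"
    using Bs C(1) null[OF neg] by (intro emeasure_Un_null_set[symmetric] sets.countable_UN') auto
  finally show ?thesis using U_eq by simp
qed

lemma lborel_distr_orthogonal_transformation:
  fixes f :: "'a::euclidean_space \<Rightarrow> 'a"
  assumes f: "orthogonal_transformation f"
  shows "distr lborel borel f = lborel"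
proof (rule lborel_eqI[symmetric])
  have [measurable]: "f \<in> borel_measurable borel"
    using orthogonal_transformation_linear[OF f]
    by (intro borel_measurable_continuous_onI)
       (simp add: linear_continuous_on linear_conv_bounded_linear)
  show "emeasure (distr lborel borel f) (box l u) = (\<Prod>b\<in>Basis. (u - l) \<bullet> b)"
    if "\<And>b. b \<in> Basis \<Longrightarrow> l \<bullet> b \<le> u \<bullet> b" for l u :: 'a
    using emeasure_vimage_orthogonal_transformation_open[OF f open_box[of l u]] that
    by (simp add: emeasure_distr emeasure_lborel_box)
qed simp

section \<open>The mean value property on balanced sets\<close>

lemma circle_mean_value:
  fixes f :: "complex \<Rightarrow> complex"
  assumes "continuous_on (cball 0 1) f" "f holomorphic_on ball 0 1"
  shows "((\<lambda>t. f (exp (2 * of_real pi * \<i> * of_real t))) has_integral f 0) {0..1}"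
proof -
  have "((\<lambda>u. f u / (u - 0)) has_contour_integral (2 * of_real pi * \<i> * f 0)) (circlepath 0 1)"
    using assms by (intro Cauchy_integral_circlepath) auto
  hence "((\<lambda>x. f (circlepath 0 1 x) / (circlepath 0 1 x) *
         vector_derivative (circlepath 0 1) (at x within {0..1})) has_integral
         (2 * of_real pi * \<i> * f 0)) {0..1}"
    unfolding has_contour_integral_def by simp
  hence main: "((\<lambda>x. (2 * of_real pi * \<i>) * f (exp (2 * of_real pi * \<i> * of_real x))) has_integral
         (2 * of_real pi * \<i> * f 0)) {0..1}"
  proof (rule has_integral_eq[rotated])
    fix x :: real assume "x \<in> {0..1}"
    hence vd: "vector_derivative (circlepath 0 1) (at x within {0..1})
        = 2 * pi * \<i> * exp (2 * of_real pi * \<i> * of_real x)"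
      by (subst vector_derivative_circlepath01) auto
    show "f (circlepath 0 1 x) / circlepath 0 1 x
            * vector_derivative (circlepath 0 1) (at x within {0..1})
        = (2 * of_real pi * \<i>) * f (exp (2 * of_real pi * \<i> * of_real x))"
      unfolding vd by (simp add: circlepath)
  qed
  have cancel: "(g has_integral c) {0..1}"
    if "((\<lambda>x. k * g x) has_integral (k * c)) {0..1}" "k \<noteq> 0"
    for k c :: complex and g :: "real \<Rightarrow> complex"
    using has_integral_mult_right[OF that(1), of "inverse k"] that(2)
    by (simp add: mult.assoc[symmetric])
  show ?thesis by (rule cancel[OF main]) simp
qed

lemma scaleR_eq_smult: "t *\<^sub>R v = of_real t *s (v::complex^'n)"
  unfolding vec_eq_iff vector_scaleR_component vector_smult_component
  by (simp add: scaleR_conv_of_real)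

lemma orthogonal_transformation_unimodular_scale:
  assumes "cmod c = 1"
  shows "orthogonal_transformation (\<lambda>v::complex^'n. c *s v)"
proof -
  have "linear (\<lambda>v::complex^'n. c *s v)"
    by (intro linearI) (simp_all add: scaleR_eq_smult vec_eq_iff algebra_simps)
  moreover have "norm (c *s v) = norm v" for v :: "complex^'n"
    using assms by (simp add: norm_vec_def norm_mult)
  ultimately show ?thesis by (simp add: orthogonal_transformation)
qed

lemma continuous_vector_scalar_mult [continuous_intros]:
  fixes f :: "'a::topological_space \<Rightarrow> complex" and g :: "'a \<Rightarrow> complex^'n"
  assumes "continuous_on S f" "continuous_on S g"
  shows "continuous_on S (\<lambda>x. f x *s g x)"
  unfolding vector_scalar_mult_def using assms by (intro continuous_intros)

lemma holomorphic_Cn_on_imp_continuous_on: "holomorphic_Cn_on f S \<Longrightarrow> continuous_on S f"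
  unfolding holomorphic_Cn_on_def
  by (meson continuous_at_imp_continuous_on has_derivative_continuous)

lemma holomorphic_on_line:
  fixes f :: "complex^'n \<Rightarrow> complex"
  assumes "holomorphic_Cn_on f S" "\<And>c. c \<in> T \<Longrightarrow> c *s v \<in> S"
  shows "(\<lambda>c. f (c *s v)) holomorphic_on T"
proof -
  have "(\<lambda>c. f (c *s v)) field_differentiable at c" if "c \<in> T" for c
  proof -
    have "c *s v \<in> S" using that by (rule assms(2))
    then obtain D where D: "(f has_derivative D) (at (c *s v))" "\<And>c v. D (c *s v) = c * D v"
      using assms(1) unfolding holomorphic_Cn_on_def by blast
    have "bounded_linear (\<lambda>c::complex. c *s v)"
      by (intro linear_conv_bounded_linear[THEN iffD1] linearI)
         (simp_all add: vec_eq_iff algebra_simps)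
    hence "((\<lambda>c. c *s v) has_derivative (\<lambda>d. d *s v)) (at c)"
      by (rule bounded_linear.has_derivative[OF _ has_derivative_ident])
    from has_derivative_compose[OF this D(1)]
    have "((\<lambda>c. f (c *s v)) has_derivative (\<lambda>d. D v * d)) (at c)"
      by (simp add: D(2) mult.commute)
    thus ?thesis unfolding field_differentiable_def has_field_derivative_def by blast
  qed
  thus ?thesis by (simp add: field_differentiable_at_within holomorphic_on_def)
qed

text \<open>
  Integrating over \<open>P\<close> is the same as integrating the rotated function \<open>z \<mapsto> f (e\<^bsup>2\<pi>it\<^esup> z)\<close>, for every
  \<open>t\<close>.  Averaging over \<open>t\<close> and exchanging the integrals leaves, for each \<open>z\<close>, the mean of \<open>f\<close> over a
  circle in the complex line through \<open>z\<close>, which is \<open>f 0\<close>.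
\<close>

lemma mean_value_balanced:
  fixes f :: "complex^'n \<Rightarrow> complex" and P :: "(complex^'n) set"
  assumes P: "open P" "emeasure lborel P < \<infinity>"
    and bal: "\<And>c z. z \<in> P \<Longrightarrow> cmod c \<le> 1 \<Longrightarrow> c *s z \<in> P"
    and f: "holomorphic_Cn_on f P" and int: "set_integrable lborel P f"
  shows "set_lebesgue_integral lborel P f = measure lborel P * f 0"
proof -
  define e where "e t = exp (2 * of_real pi * \<i> * of_real t)" for t :: real
  define F where "F t z = indicator ({0..1} \<times> P) (t,z) *\<^sub>R f (e t *s z)" for t z
  have e1: "cmod (e t) = 1" for t unfolding e_def by simp
  have e_cont: "continuous_on X e" for X unfolding e_def by (intro continuous_intros)
  have fcont: "continuous_on P f" using f by (rule holomorphic_Cn_on_imp_continuous_on)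
  have balP: "e t *s z \<in> P \<longleftrightarrow> z \<in> P" for t z
  proof
    assume "e t *s z \<in> P"
    hence "inverse (e t) *s (e t *s z) \<in> P" by (rule bal) (simp add: norm_inverse e1)
    moreover have "e t \<noteq> 0" by (simp add: e_def)
    ultimately show "z \<in> P" by (simp add: vector_smult_assoc)
  qed (auto intro: bal simp: e1)
  have Fm: "case_prod F \<in> borel_measurable (lborel \<Otimes>\<^sub>M lborel)"
  proof -
    have "continuous_on (UNIV \<times> P) (\<lambda>x. f (e (fst x) *s snd x))"
      by (rule continuous_on_compose2[OF fcont])
         (auto simp: balP intro!: continuous_intros continuous_on_compose2[OF e_cont])
    hence "continuous_on ({0..1} \<times> P) (\<lambda>x. f (e (fst x) *s snd x))"
      by (rule continuous_on_subset) auto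
    moreover have "{0..1::real} \<times> P \<in> sets borel"
      using P(1) by (intro borel_Times) auto
    ultimately have "(\<lambda>x. indicator ({0..1} \<times> P) x *\<^sub>R f (e (fst x) *s snd x)) \<in> borel_measurable borel"
      by (intro borel_measurable_continuous_on_indicator) auto
    thus ?thesis unfolding lborel_prod F_def by (simp add: case_prod_unfold)
  qed
  have dist: "distr lborel borel (\<lambda>z. e t *s z) = (lborel :: (complex^'n) measure)" for t
    by (intro lborel_distr_orthogonal_transformation orthogonal_transformation_unimodular_scale e1)
  have rotm: "(\<lambda>z::complex^'n. e t *s z) \<in> borel_measurable borel" for t
    by (intro borel_measurable_continuous_onI continuous_intros)
  define G where "G z = indicator P z *\<^sub>R f z" for z
  have Gi: "integrable lborel G" using int unfolding G_def set_integrable_def .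
  have F_eq: "F t z = indicator {0..1} t *\<^sub>R G (e t *s z)" for t z
    unfolding F_def G_def by (auto simp: balP indicator_def)
  have rot: "integrable lborel (\<lambda>z. G (e t *s z)) \<and> (\<integral>z. G (e t *s z) \<partial>lborel) = integral\<^sup>L lborel G"
    for t
  proof
    have "integrable (distr lborel borel (\<lambda>z. e t *s z)) G" unfolding dist by (rule Gi)
    thus "integrable lborel (\<lambda>z. G (e t *s z))"
      by (rule integrable_distr[rotated]) (use rotm in simp)
    have "(\<integral>z. G z \<partial>distr lborel borel (\<lambda>z. e t *s z)) = (\<integral>z. G (e t *s z) \<partial>lborel)"
      using rotm Gi by (intro integral_distr) (auto simp: integrable_iff_bounded)
    thus "(\<integral>z. G (e t *s z) \<partial>lborel) = integral\<^sup>L lborel G" unfolding dist by simp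
  qed
  have nrot: "(\<integral>z. norm (G (e t *s z)) \<partial>lborel) = (\<integral>z. norm (G z) \<partial>lborel)" for t
  proof -
    have "(\<integral>z. norm (G z) \<partial>distr lborel borel (\<lambda>z. e t *s z)) = (\<integral>z. norm (G (e t *s z)) \<partial>lborel)"
      using rotm Gi by (intro integral_distr) (auto simp: integrable_iff_bounded)
    thus ?thesis unfolding dist by simp
  qed
  have ind: "integrable lborel (\<lambda>t::real. indicator {0..1} t *\<^sub>R c)" for c :: "'b::{banach,second_countable_topology}"
    by simp
  have F_int: "integrable (lborel \<Otimes>\<^sub>M lborel) (case_prod F)"
  proof (rule lborel_pair.Fubini_integrable[OF Fm])
    have "(\<lambda>t. \<integral>z. norm (case_prod F (t,z)) \<partial>lborel) =
          (\<lambda>t. indicator {0..1} t *\<^sub>R (\<integral>z. norm (G z) \<partial>lborel))"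
      by (rule ext) (simp add: F_eq nrot)
    thus "integrable lborel (\<lambda>t. \<integral>z. norm (case_prod F (t,z)) \<partial>lborel)" using ind by simp
    show "AE t in lborel. integrable lborel (\<lambda>z. case_prod F (t,z))"
      by (rule AE_I2) (simp add: F_eq rot)
  qed
  have t_int: "(\<integral>t. F t z \<partial>lborel) = indicator P z *\<^sub>R f 0" for z
  proof (cases "z \<in> P")
    case True
    have c1: "continuous_on (cball 0 1) (\<lambda>c. f (c *s z))"
      by (rule continuous_on_compose2[OF fcont]) (auto intro!: continuous_intros bal True)
    have h1: "(\<lambda>c. f (c *s z)) holomorphic_on ball 0 1"
      by (rule holomorphic_on_line[OF f]) (auto intro!: bal True)
    have "((\<lambda>t. f (e t *s z)) has_integral f (0 *s z)) {0..1}"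
      unfolding e_def by (rule circle_mean_value[OF c1 h1])
    moreover have "set_integrable lborel {0..1} (\<lambda>t. f (e t *s z))"
    proof (intro borel_integrable_atLeastAtMost')
      show "continuous_on {0..1} (\<lambda>t. f (e t *s z))"
        by (rule continuous_on_compose2[OF fcont]) (auto intro!: continuous_intros e_cont simp: balP True)
    qed
    ultimately have "set_lebesgue_integral lborel {0..1} (\<lambda>t. f (e t *s z)) = f 0"
      by (simp add: set_borel_integral_eq_integral(2) integral_unique)
    thus ?thesis using True unfolding F_def set_lebesgue_integral_def by (simp add: indicator_def)
  qed (simp add: F_def)
  have "integral\<^sup>L lborel G = (\<integral>t. indicator {0..1} t *\<^sub>R integral\<^sup>L lborel G \<partial>(lborel::real measure))"
    by simp
  also have "\<dots> = (\<integral>t. (\<integral>z. F t z \<partial>lborel) \<partial>lborel)"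
    by (intro Bochner_Integration.integral_cong refl) (simp add: F_eq rot)
  also have "\<dots> = (\<integral>z. (\<integral>t. F t z \<partial>lborel) \<partial>lborel)"
    by (rule lborel_pair.Fubini_integral[OF F_int, symmetric])
  also have "\<dots> = measure lborel P *\<^sub>R f 0"
    using P unfolding t_int by simp
  finally show ?thesis unfolding G_def set_lebesgue_integral_def by (simp add: scaleR_conv_of_real)
qed

section \<open>Unitary diagonalization of Hermitian matrices\<close>

definition herm :: "complex^'n \<Rightarrow> complex^'n \<Rightarrow> complex" where
  "herm u v = (\<Sum>i\<in>UNIV. cnj (u $ i) * v $ i)"

lemma herm_add_right: "herm u (v + w) = herm u v + herm u w"
  and herm_scale_right: "herm u (c *s v) = c * herm u v"
  and herm_scale_left: "herm (c *s u) v = cnj c * herm u v"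
  and herm_cnj: "cnj (herm u v) = herm v u"
  by (simp_all add: herm_def algebra_simps sum.distrib sum_distrib_left)

lemma herm_self: "herm u u = of_real ((norm u)\<^sup>2)"
proof -
  have "herm u u = (\<Sum>i\<in>UNIV. of_real ((cmod (u $ i))\<^sup>2))"
    unfolding herm_def complex_norm_square by (simp add: mult.commute)
  also have "\<dots> = of_real ((norm u)\<^sup>2)"
    unfolding norm_vec_def L2_set_def by (simp add: sum_nonneg)
  finally show ?thesis .
qed

lemma inner_eq_Re_herm: "inner u v = Re (herm u v)"
  by (simp add: inner_vec_def herm_def inner_complex_def)

lemma herm_adjoint:
  fixes M :: "complex^'n^'n"
  shows "herm u (M *v v) = herm ((\<chi> i j. cnj (M $ j $ i)) *v u) v"
proof -
  have "herm u (M *v v) = (\<Sum>i\<in>UNIV. \<Sum>j\<in>UNIV. cnj (u $ i) * (M $ i $ j * v $ j))"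
    by (simp add: herm_def matrix_vector_mult_def sum_distrib_left)
  also have "\<dots> = (\<Sum>j\<in>UNIV. \<Sum>i\<in>UNIV. cnj (u $ i) * (M $ i $ j * v $ j))"
    by (rule sum.swap)
  also have "\<dots> = herm ((\<chi> i j. cnj (M $ j $ i)) *v u) v"
    by (simp add: herm_def matrix_vector_mult_def sum_distrib_left sum_distrib_right mult_ac)
  finally show ?thesis .
qed

lemma herm_matrix_adjoint:
  fixes H :: "complex^'n^'n"
  assumes "\<And>j k. H $ k $ j = cnj (H $ j $ k)"
  shows "herm u (H *v v) = herm (H *v u) v"
proof -
  have "(\<chi> i j. cnj (H $ j $ i)) = H"
    by (simp add: vec_eq_iff assms[symmetric])
  with herm_adjoint[of u H v] show ?thesis by simp
qed

lemma unitary_matrix_orthogonal_transformation: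
  fixes A :: "complex^'n^'n"
  assumes "unitary_matrix A"
  shows "orthogonal_transformation ((*v) A)"
proof -
  have "linear ((*v) A)"
    by (intro linearI matrix_vector_right_distrib)
       (simp add: scaleR_eq_smult vec_eq_iff matrix_vector_mult_def sum_distrib_left mult_ac)
  moreover have "norm (A *v v) = norm v" for v
  proof -
    have "herm (A *v v) (A *v v) = herm v v"
      using assms unfolding unitary_matrix_def
      by (simp add: herm_adjoint matrix_vector_mul_assoc)
    hence "(norm (A *v v))\<^sup>2 = (norm v)\<^sup>2" unfolding herm_self of_real_eq_iff .
    thus ?thesis by simp
  qed
  ultimately show ?thesis by (simp add: orthogonal_transformation)
qed

text \<open>
  The eigenvectors are found one at a time.  The orthogonal complement \<open>W\<close> of those already found is
  \<open>H\<close>-invariant and nonzero, and a unit vector \<open>v \<in> W\<close> that maximizes the Rayleigh quotient is an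
  eigenvector: the form \<open>N w = l |w|\<^sup>2 - \<langle>w, H w\<rangle>\<close>, with \<open>l\<close> the maximum, is nonnegative on \<open>W\<close> and
  vanishes at \<open>v\<close>, so its derivative at \<open>v\<close> in the direction \<open>l v - H v \<in> W\<close> vanishes too.
\<close>

lemma hermitian_orthonormal_eigenvectors:
  fixes H :: "complex^'n^'n"
  assumes H: "\<And>j k. H $ k $ j = cnj (H $ j $ k)"
    and "finite (I :: 'n set)"
  shows "\<exists>u (d :: 'n \<Rightarrow> real). (\<forall>i\<in>I. H *v u i = of_real (d i) *s u i) \<and>
               (\<forall>i\<in>I. \<forall>j\<in>I. herm (u i) (u j) = (if i = j then 1 else 0))"
  using assms(2)
proof (induction I)
  case empty then show ?case by simp
next
  case (insert k I)
  then obtain u and d :: "'n \<Rightarrow> real"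
    where eig: "\<And>i. i \<in> I \<Longrightarrow> H *v u i = of_real (d i) *s u i"
      and on: "\<And>i j. i \<in> I \<Longrightarrow> j \<in> I \<Longrightarrow> herm (u i) (u j) = (if i = j then 1 else 0)"
    by blast
  define W where "W = {v. \<forall>i\<in>I. herm (u i) v = 0}"
  have W_add: "x + y \<in> W" if "x \<in> W" "y \<in> W" for x y
    using that by (auto simp: W_def herm_add_right)
  have W_smult: "c *s x \<in> W" if "x \<in> W" for x c
    using that by (auto simp: W_def herm_scale_right)
  have W_scale: "c *\<^sub>R x \<in> W" if "x \<in> W" for x c
    using W_smult[OF that] by (simp add: scaleR_eq_smult)
  have W_H: "H *v x \<in> W" if "x \<in> W" for x
    using that by (auto simp: W_def herm_matrix_adjoint[OF H] eig herm_scale_left)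
  have H_add: "H *v (x + y) = H *v x + H *v y" for x y
    by (rule matrix_vector_right_distrib)
  have H_scale: "H *v (c *\<^sub>R x) = c *\<^sub>R (H *v x)" for x c
    by (simp add: scaleR_eq_smult vec_eq_iff matrix_vector_mult_def sum_distrib_left mult_ac)
  \<comment> \<open>The conditions defining \<open>W\<close> are the components in \<open>I\<close> of a linear endomorphism \<open>L\<close>
      whose \<open>k\<close>-th component is zero.  So \<open>L\<close> is not onto, hence not injective.\<close>
  obtain v0 where v0: "v0 \<in> W" "v0 \<noteq> 0"
  proof -
    define L where "L v = (\<chi> i. if i \<in> I then herm (u i) v else 0)" for v
    have lin: "linear L"
      by (intro linearI)
         (auto simp: L_def vec_eq_iff herm_add_right herm_scale_right scaleR_eq_smult)
    have "L v \<noteq> axis k 1" for v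
    proof
      assume "L v = axis k 1"
      hence "L v $ k = 1" by simp
      thus False using insert.hyps by (simp add: L_def)
    qed
    hence "\<not> surj L" by (metis surjD)
    hence "\<not> inj L" using linear_injective_imp_surjective[OF lin] by blast
    then obtain x where x: "L x = 0" "x \<noteq> 0" using linear_injective_0[OF lin] by blast
    have "herm (u i) x = 0" if "i \<in> I" for i
      using arg_cong[OF x(1), of "\<lambda>w. w $ i"] that by (simp add: L_def)
    hence "x \<in> W" by (simp add: W_def)
    with x(2) show ?thesis using that by blast
  qed
  have W_closed: "closed W"
  proof -
    have "W = (\<Inter>i\<in>I. {v. herm (u i) v = 0})" by (auto simp: W_def)
    also have "closed \<dots>"
      unfolding herm_def by (intro closed_INT ballI closed_Collect_eq continuous_intros)
    finally show ?thesis .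
  qed
  have comp: "compact (sphere 0 1 \<inter> W)" using W_closed by (intro compact_Int_closed) auto
  have "(1 / norm v0) *\<^sub>R v0 \<in> sphere 0 1 \<inter> W" using v0 W_scale by auto
  hence ne: "sphere 0 1 \<inter> W \<noteq> {}" by blast
  have cont: "continuous_on (sphere 0 1 \<inter> W) (\<lambda>v. inner v (H *v v))"
    unfolding matrix_vector_mult_def by (intro continuous_intros)
  obtain v where v: "v \<in> W" "norm v = 1"
    and vmax: "\<And>w. w \<in> W \<Longrightarrow> norm w = 1 \<Longrightarrow> inner w (H *v w) \<le> inner v (H *v v)"
    using continuous_attains_sup[OF comp ne cont] by auto
  define l where "l = inner v (H *v v)"
  define N where "N w = l * inner w w - inner w (H *v w)" for w
  have N_nonneg: "N w \<ge> 0" if "w \<in> W" for w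
  proof (cases "w = 0")
    case False
    define w' where "w' = (1 / norm w) *\<^sub>R w"
    have w: "w = norm w *\<^sub>R w'" using False by (simp add: w'_def)
    have "inner w' (H *v w') \<le> l"
      unfolding l_def using that False by (intro vmax) (auto simp: w'_def W_scale)
    hence "(norm w)\<^sup>2 * inner w' (H *v w') \<le> (norm w)\<^sup>2 * l" by (intro mult_left_mono) auto
    moreover have "inner w (H *v w) = (norm w)\<^sup>2 * inner w' (H *v w')"
      by (subst (1 2) w) (simp only: H_scale inner_scaleR_left inner_scaleR_right power2_eq_square mult_ac)
    ultimately show ?thesis by (simp add: N_def power2_norm_eq_inner mult.commute)
  qed (simp add: N_def)
  define x where "x = l *\<^sub>R v - H *v v"
  have x: "x \<in> W"
    unfolding x_def using W_add[OF W_scale[OF v(1), of l] W_scale[OF W_H[OF v(1)], of "-1"]] by simp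
  have sym: "inner v (H *v x) = inner x (H *v v)"
    by (metis herm_matrix_adjoint[OF H] inner_eq_Re_herm inner_commute)
  have quad: "N (v + t *\<^sub>R x) = 2 * t * inner x x + t\<^sup>2 * N x" for t
  proof -
    have vv: "inner v v = 1" using v(2) by (simp add: norm_eq_1)
    have xx: "inner x x = l * inner v x - inner x (H *v v)"
      by (subst (2) x_def) (simp add: inner_diff_right inner_commute)
    show ?thesis
      unfolding N_def H_add H_scale
      by (simp add: inner_add_left inner_add_right vv xx sym l_def[symmetric] inner_commute[of x v])
         (simp add: algebra_simps power2_eq_square)
  qed
  have "x = 0"
  proof (rule ccontr)
    assume "x \<noteq> 0"
    define c where "c = inner x x"
    have c: "c > 0" using \<open>x \<noteq> 0\<close> by (simp add: c_def)
    have Nx: "N x \<ge> 0" by (rule N_nonneg[OF x])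
    \<comment> \<open>A small negative step from \<open>v\<close> along \<open>x\<close> would make \<open>N\<close> negative.\<close>
    define t where "t = - c / (N x + 1)"
    have t: "t < 0" using c Nx by (simp add: t_def)
    have tN: "t * (N x + 1) = - c" using Nx by (simp add: t_def)
    have "0 \<le> 2 * t * c + t\<^sup>2 * N x"
      using N_nonneg[OF W_add[OF v(1) W_scale[OF x]], of t] by (simp add: quad c_def)
    also have "\<dots> = t * (2 * c + t * N x)" by (simp add: algebra_simps power2_eq_square)
    also have "2 * c + t * N x = c - t" using tN by (simp add: algebra_simps)
    finally have "0 \<le> t * (c - t)" .
    moreover have "t * (c - t) < 0" using t c by (simp add: mult_neg_pos)
    ultimately show False by linarith
  qed
  hence eig_v: "H *v v = of_real l *s v" by (simp add: x_def scaleR_eq_smult)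
  have vu: "herm (u i) v = 0" "herm v (u i) = 0" if "i \<in> I" for i
    using v(1) that herm_cnj[of "u i" v] by (auto simp: W_def)
  have vv: "herm v v = 1" using v(2) by (simp add: herm_self)
  show ?case
    using insert.hyps
    by (intro exI[of _ "u(k := v)"] exI[of _ "d(k := l)"]) (auto simp: eig eig_v on vu vv)
qed

lemma sum_const_poly: "(\<Sum>k\<in>A. [:f k:]) = [:\<Sum>k\<in>A. f k:]"
  by (induction A rule: infinite_finite_induct) auto

text \<open>
  The usual argument \<open>t - H = U (t - D) U\<^sup>-\<^sup>1\<close>, carried out with matrices over the polynomial ring:
  \<open>C\<close> embeds the constant matrices and \<open>X\<close> forms the characteristic matrix.
\<close>

lemma char_polynomial_similar:
  fixes H D U V :: "complex^'n^'n"
  assumes HU: "H ** U = U ** D" and VU: "V ** U = mat 1"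
  shows "char_polynomial H = char_polynomial D"
proof -
  define C where "C M = (\<chi> i j. [:M $ i $ j:])" for M :: "complex^'n^'n"
  define X where "X M = (\<chi> i j. (if i = j then [:0, 1:] else 0) - [:M $ i $ j:])"
    for M :: "complex^'n^'n"
  have C_mult: "C M ** C M' = C (M ** M')" for M M'
    by (simp add: C_def matrix_matrix_mult_def vec_eq_iff sum_const_poly mult.commute)
  have 1: "X M ** C M' = (\<chi> i j. smult (M' $ i $ j) [:0, 1:]) - C (M ** M')" for M M'
    by (simp add: X_def C_def matrix_matrix_mult_def vec_eq_iff left_diff_distrib sum_subtractf
        sum_const_poly smult_diff_right if_distrib[of "smult _"] mult.commute cong: if_cong)
  have 2: "C M' ** X M = (\<chi> i j. smult (M' $ i $ j) [:0, 1:]) - C (M' ** M)" for M M'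
    by (simp add: X_def C_def matrix_matrix_mult_def vec_eq_iff right_diff_distrib sum_subtractf
        sum_const_poly if_distrib[of "\<lambda>x. _ * x"] cong: if_cong)
       (simp add: mult.commute)
  have "X H ** C U = C U ** X D" unfolding 1 2 HU ..
  hence "det (X H) * det (C U) = det (X D) * det (C U)"
    by (metis det_mul mult.commute)
  moreover have "det (C U) \<noteq> 0"
  proof
    assume "det (C U) = 0"
    moreover have "C (mat 1) = mat 1" by (simp add: C_def mat_def vec_eq_iff one_pCons)
    ultimately have "det (mat 1 :: complex poly^'n^'n) = 0"
      using C_mult[of V U] by (metis VU det_mul mult_zero_right)
    thus False by simp
  qed
  ultimately show ?thesis unfolding char_polynomial_def X_def by simp
qed

lemma eigenvalues_diagonal:
  fixes d :: "'n::finite \<Rightarrow> complex"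
  shows "eigenvalues (\<chi> i j. if i = j then d i else 0) = image_mset d (mset_set UNIV)"
proof -
  have "char_polynomial (\<chi> i j. if i = j then d i else 0) = (\<Prod>i\<in>UNIV. [:- d i, 1:])"
    unfolding char_polynomial_def by (subst det_diagonal) (auto intro!: prod.cong)
  hence "eigenvalues (\<chi> i j. if i = j then d i else 0) = (\<Sum>i\<in>UNIV. proots [:- d i, 1:])"
    unfolding eigenvalues_def by (simp add: proots_prod)
  also have "\<dots> = (\<Sum>i\<in>UNIV. {#d i#})" by simp
  also have "\<dots> = image_mset d (mset_set UNIV)"
  proof -
    have "(\<Sum>i\<in>A. {#d i#}) = image_mset d (mset_set A)" if "finite A" for A
      using that by induction auto
    thus ?thesis by simp
  qed
  finally show ?thesis .
qed

lemma unitary_matrix_permute_columns: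
  fixes A :: "complex^'n^'n"
  assumes "unitary_matrix A" and p: "bij p"
  shows "unitary_matrix (\<chi> i j. A $ i $ p j)"
proof -
  define V where "V = (\<chi> i j. cnj (A $ j $ i))"
  have AV: "A ** V = mat 1" "V ** A = mat 1"
    using assms(1) unfolding unitary_matrix_def V_def by auto
  have "(\<Sum>k\<in>UNIV. A $ i $ p k * cnj (A $ j $ p k)) = (\<Sum>k\<in>UNIV. A $ i $ k * cnj (A $ j $ k))" for i j
    by (rule sum.reindex_bij_betw[OF p])
  moreover have "(\<Sum>k\<in>UNIV. A $ i $ k * cnj (A $ j $ k)) = (A ** V) $ i $ j" for i j
    by (simp add: V_def matrix_matrix_mult_def)
  moreover have "(\<Sum>k\<in>UNIV. cnj (A $ k $ p i) * A $ k $ p j) = (V ** A) $ p i $ p j" for i j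
    by (simp add: V_def matrix_matrix_mult_def)
  ultimately show ?thesis
    unfolding unitary_matrix_def
    using AV p by (simp add: matrix_matrix_mult_def[of "\<chi> i j. _ i j"] vec_eq_iff mat_def bij_is_inj inj_eq)
qed

lemma matrix_vector_mult_permute_columns:
  fixes A :: "complex^'n^'n"
  assumes p: "bij p"
  shows "(\<chi> i j. A $ i $ p j) *v z = A *v (\<chi> k. z $ inv p k)"
proof -
  have "(\<Sum>j\<in>UNIV. A $ i $ p j * z $ inv p (p j)) = (\<Sum>k\<in>UNIV. A $ i $ k * z $ inv p k)" for i
    by (rule sum.reindex_bij_betw[OF p])
  thus ?thesis using p by (simp add: matrix_vector_mult_def vec_eq_iff bij_is_inj)
qed

text \<open>
  The form in question conjugates its second argument, whereas \<open>\<langle>u, H u\<rangle>\<close>, which an orthonormal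
  eigenbasis makes diagonal, conjugates its first one.  Hence the columns of \<open>A\<close> are the conjugates
  of the eigenvectors.
\<close>

lemma hermitian_diagonalization:
  fixes H :: "complex^'n^'n"
  assumes H: "\<And>j k. H $ k $ j = cnj (H $ j $ k)"
  obtains A and d :: "'n \<Rightarrow> real" where "unitary_matrix A"
    and "\<And>z. (\<Sum>j\<in>UNIV. \<Sum>k\<in>UNIV. H $ j $ k * (A *v z) $ j * cnj ((A *v z) $ k))
            = of_real (\<Sum>i\<in>UNIV. d i * (cmod (z $ i))\<^sup>2)"
    and "eigenvalues H = image_mset (\<lambda>i. of_real (d i)) (mset_set UNIV)"
proof -
  obtain u and d :: "'n \<Rightarrow> real"
    where eig: "\<And>i. H *v u i = of_real (d i) *s u i"
      and on: "\<And>i j. herm (u i) (u j) = (if i = j then 1 else 0)"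
    using hermitian_orthonormal_eigenvectors[OF H, of UNIV] by auto
  define U where "U = (\<chi> i a. u a $ i)"
  define V where "V = (\<chi> a i. cnj (u a $ i))"
  define D :: "complex^'n^'n" where "D = (\<chi> i j. if i = j then of_real (d i) else 0)"
  define A where "A = (\<chi> i a. cnj (u a $ i))"
  have VU: "V ** U = mat 1"
    using on by (simp add: vec_eq_iff V_def U_def matrix_matrix_mult_def mat_def herm_def)
  hence UV: "U ** V = mat 1" by (rule matrix_left_right_inverse[THEN iffD1])
  have HU: "H ** U = U ** D"
  proof -
    have "(\<Sum>k\<in>UNIV. H $ i $ k * u a $ k) = u a $ i * of_real (d a)" for i a
      using arg_cong[OF eig[of a], of "\<lambda>w. w $ i"] by (simp add: matrix_vector_mult_def mult.commute)
    thus ?thesis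
      by (simp add: vec_eq_iff U_def D_def matrix_matrix_mult_def if_distrib[of "\<lambda>x. _ * x"] cong: if_cong)
  qed
  have "unitary_matrix A"
  proof -
    have "A ** (\<chi> i j. cnj (A $ j $ i)) = (\<chi> i j. cnj ((U ** V) $ i $ j))"
      by (simp add: vec_eq_iff A_def U_def V_def matrix_matrix_mult_def)
    moreover have "(\<chi> i j. cnj (A $ j $ i)) ** A = (\<chi> i j. cnj ((V ** U) $ i $ j))"
      by (simp add: vec_eq_iff A_def U_def V_def matrix_matrix_mult_def)
    ultimately show ?thesis unfolding unitary_matrix_def VU UV by (simp add: vec_eq_iff mat_def)
  qed
  moreover have "(\<Sum>j\<in>UNIV. \<Sum>k\<in>UNIV. H $ j $ k * (A *v z) $ j * cnj ((A *v z) $ k))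
            = of_real (\<Sum>i\<in>UNIV. d i * (cmod (z $ i))\<^sup>2)" for z
  proof -
    define w where "w = (\<Sum>a\<in>UNIV. cnj (z $ a) *s u a)"
    have w: "cnj ((A *v z) $ k) = w $ k" for k
      by (simp add: w_def A_def matrix_vector_mult_def mult.commute)
    have w': "(A *v z) $ k = cnj (w $ k)" for k
      using w[of k] by (metis complex_cnj_cnj)
    have Hw: "H *v w = (\<Sum>a\<in>UNIV. (of_real (d a) * cnj (z $ a)) *s u a)"
    proof -
      have "H *v w = (\<Sum>a\<in>UNIV. H *v (cnj (z $ a) *s u a))"
      proof -
        have "H *v (\<Sum>a\<in>S. f a) = (\<Sum>a\<in>S. H *v f a)" for f and S :: "'n set"
          by (induction S rule: infinite_finite_induct) (auto simp: matrix_vector_right_distrib)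
        thus ?thesis unfolding w_def .
      qed
      also have "\<dots> = (\<Sum>a\<in>UNIV. cnj (z $ a) *s (H *v u a))"
        by (intro sum.cong refl)
           (simp add: vec_eq_iff matrix_vector_mult_def sum_distrib_left mult_ac)
      finally show ?thesis by (simp add: eig vector_smult_assoc mult.commute)
    qed
    have hs: "herm x (\<Sum>a\<in>S. y a) = (\<Sum>a\<in>S. herm x (y a))"
      for x and y :: "'n \<Rightarrow> complex^'n" and S
      by (induction S rule: infinite_finite_induct) (auto simp: herm_add_right, auto simp: herm_def)
    have wu: "herm w (u a) = z $ a" for a
    proof -
      have "herm (u a) w = cnj (z $ a)"
        unfolding w_def hs herm_scale_right on by (simp add: if_distrib[of "\<lambda>x. _ * x"] cong: if_cong)
      thus ?thesis using herm_cnj[of "u a" w] by simp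
    qed
    have "(\<Sum>j\<in>UNIV. \<Sum>k\<in>UNIV. H $ j $ k * (A *v z) $ j * cnj ((A *v z) $ k))
        = (\<Sum>j\<in>UNIV. cnj (w $ j) * (H *v w) $ j)"
      unfolding w' by (simp add: matrix_vector_mult_def sum_distrib_left mult_ac)
    also have "\<dots> = herm w (H *v w)" by (simp add: herm_def)
    also have "\<dots> = (\<Sum>a\<in>UNIV. of_real (d a) * cnj (z $ a) * z $ a)"
      unfolding Hw hs herm_scale_right wu ..
    also have "\<dots> = (\<Sum>i\<in>UNIV. of_real (d i * (cmod (z $ i))\<^sup>2))"
      by (intro sum.cong refl) (simp only: of_real_mult complex_norm_square mult_ac)
    also have "\<dots> = of_real (\<Sum>i\<in>UNIV. d i * (cmod (z $ i))\<^sup>2)" by simp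
    finally show ?thesis .
  qed
  moreover have "eigenvalues H = image_mset (\<lambda>i. of_real (d i)) (mset_set UNIV)"
    using char_polynomial_similar[OF HU VU] eigenvalues_diagonal[of "\<lambda>i. of_real (d i)"]
    unfolding eigenvalues_def D_def by simp
  ultimately show ?thesis by (rule that)
qed

section \<open>Second-order Taylor expansion\<close>

lemma C2_on_has_derivatives:
  fixes f :: "'a::real_normed_vector \<Rightarrow> 'b::real_normed_vector"
  assumes "Ck_on 2 f S" "x \<in> S"
  shows "(f has_derivative frechet_derivative f (at x)) (at x)"
    and "((\<lambda>y. frechet_derivative f (at y) v) has_derivative
           frechet_derivative (\<lambda>y. frechet_derivative f (at y) v) (at x)) (at x)"
  using assms by (auto simp: eval_nat_numeral frechet_derivative_works)

definition second_derivative :: "('a::real_normed_vector \<Rightarrow> real) \<Rightarrow> 'a \<Rightarrow> 'a \<Rightarrow> 'a \<Rightarrow> real" where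
  "second_derivative f a u v = frechet_derivative (\<lambda>x. frechet_derivative f (at x) v) (at a) u"

context
  fixes f :: "'a::euclidean_space \<Rightarrow> real" and S a D B
  assumes S: "open S" and a: "a \<in> S" and C2: "Ck_on 2 f S"
  defines "D \<equiv> \<lambda>x. frechet_derivative f (at x)"
    and "B \<equiv> second_derivative f a"
begin

lemma D_has_derivative: "x \<in> S \<Longrightarrow> (f has_derivative D x) (at x)"
  unfolding D_def by (rule C2_on_has_derivatives[OF C2])

lemma B_has_derivative: "((\<lambda>x. D x v) has_derivative (\<lambda>u. B u v)) (at a)"
  unfolding D_def B_def second_derivative_def
  using C2_on_has_derivatives(2)[OF C2 a, of v] by simp

lemma D_linear: "x \<in> S \<Longrightarrow> linear (D x)"
  using D_has_derivative has_derivative_linear by blast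

lemma second_derivative_linear_left: "linear (\<lambda>u. B u v)"
  using B_has_derivative has_derivative_linear by blast

lemma second_derivative_linear_right: "linear (B u)"
proof (rule linearI)
  fix v w
  have "((\<lambda>x. D x v + D x w) has_derivative (\<lambda>u. B u v + B u w)) (at a)"
    by (intro has_derivative_add B_has_derivative)
  hence "((\<lambda>x. D x (v + w)) has_derivative (\<lambda>u. B u v + B u w)) (at a)"
    by (rule has_derivative_transform_within_open[OF _ S a]) (simp add: linear_add[OF D_linear])
  from has_derivative_unique[OF this B_has_derivative] show "B u (v + w) = B u v + B u w" by metis
next
  fix c v
  have "((\<lambda>x. c * D x v) has_derivative (\<lambda>u. c * B u v)) (at a)"
    by (intro has_derivative_mult_right B_has_derivative)
  hence "((\<lambda>x. D x (c *\<^sub>R v)) has_derivative (\<lambda>u. c * B u v)) (at a)"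
    by (rule has_derivative_transform_within_open[OF _ S a]) (simp add: linear_scale[OF D_linear])
  from has_derivative_unique[OF this B_has_derivative] show "B u (c *\<^sub>R v) = c *\<^sub>R B u v" by (simp, metis)
qed

text \<open>
  Differentiability of \<open>x \<mapsto> D x v\<close> at \<open>a\<close>, made uniform in the direction \<open>v\<close>: it is enough to treat
  the finitely many basis directions, because everything is linear in \<open>v\<close>.
\<close>

lemma derivative_expansion:
  assumes "\<epsilon> > 0"
  obtains \<delta> where "\<delta> > 0"
    "\<And>x v. norm x < \<delta> \<Longrightarrow> a + x \<in> S \<and> \<bar>D (a + x) v - D a v - B x v\<bar> \<le> \<epsilon> * norm x * norm v"
proof -
  define e where "e = \<epsilon> / real DIM('a)"
  have e: "e > 0" using assms by (simp add: e_def)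
  have "\<forall>\<^sub>F x in nhds 0. \<bar>D (a + x) b - D a b - B x b\<bar> \<le> e * norm x" for b
  proof -
    obtain d where "d > 0" "\<And>y. norm (y - a) < d \<Longrightarrow> norm (D y b - D a b - B (y - a) b) \<le> e * norm (y - a)"
      using B_has_derivative[of b] e unfolding has_derivative_at_alt by blast
    from this(1) this(2)[of "a + _"] show ?thesis
      unfolding eventually_nhds_metric by (intro exI[of _ d]) auto
  qed
  hence "\<forall>\<^sub>F x in nhds 0. \<forall>b\<in>Basis. \<bar>D (a + x) b - D a b - B x b\<bar> \<le> e * norm x"
    by (intro eventually_ball_finite) auto
  moreover have "\<forall>\<^sub>F x in nhds 0. a + x \<in> S"
  proof -
    have "open ((\<lambda>x. a + x) -` S)" using S by (intro open_vimage continuous_intros)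
    thus ?thesis using a eventually_nhds_in_open[of "(\<lambda>x. a + x) -` S" 0] by simp
  qed
  ultimately have "\<forall>\<^sub>F x in nhds 0. a + x \<in> S \<and>
      (\<forall>b\<in>Basis. \<bar>D (a + x) b - D a b - B x b\<bar> \<le> e * norm x)"
    by eventually_elim auto
  then obtain \<delta> where \<delta>: "\<delta> > 0" and *: "\<And>x. norm x < \<delta> \<Longrightarrow> a + x \<in> S \<and>
      (\<forall>b\<in>Basis. \<bar>D (a + x) b - D a b - B x b\<bar> \<le> e * norm x)"
    unfolding eventually_nhds_metric dist_norm by auto
  show thesis
  proof (rule that[OF \<delta>])
    fix x v :: 'a assume x: "norm x < \<delta>"
    hence xS: "a + x \<in> S" and bd: "\<And>b. b \<in> Basis \<Longrightarrow> \<bar>D (a + x) b - D a b - B x b\<bar> \<le> e * norm x"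
      using * by auto
    define L where "L = (\<lambda>v. D (a + x) v - D a v - B x v)"
    have L: "linear L"
      unfolding L_def by (intro linear_compose_sub D_linear a xS second_derivative_linear_right)
    have "L v = L (\<Sum>b\<in>Basis. (v \<bullet> b) *\<^sub>R b)" by (simp add: euclidean_representation)
    also have "\<dots> = (\<Sum>b\<in>Basis. (v \<bullet> b) * L b)"
      by (simp add: linear_sum[OF L] linear_scale[OF L])
    also have "\<bar>\<dots>\<bar> \<le> (\<Sum>b\<in>Basis. \<bar>(v \<bullet> b) * L b\<bar>)" by (rule sum_abs)
    also have "\<dots> \<le> (\<Sum>b\<in>(Basis::'a set). norm v * (e * norm x))"
      using bd by (intro sum_mono) (auto simp: abs_mult L_def intro!: mult_mono Basis_le_norm)
    also have "\<dots> = \<epsilon> * norm x * norm v" by (simp add: e_def)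
    finally show "a + x \<in> S \<and> \<bar>D (a + x) v - D a v - B x v\<bar> \<le> \<epsilon> * norm x * norm v"
      using xS by (simp add: L_def)
  qed
qed

lemma derivative_along_line:
  assumes "p + t *\<^sub>R v \<in> S"
  shows "((\<lambda>t. f (p + t *\<^sub>R v)) has_real_derivative D (p + t *\<^sub>R v) v) (at t)"
proof -
  have "((\<lambda>t. p + t *\<^sub>R v) has_derivative (\<lambda>s. s *\<^sub>R v)) (at t)"
    by (auto intro!: derivative_eq_intros)
  from has_derivative_compose[OF this D_has_derivative[OF assms]] show ?thesis
    unfolding has_field_derivative_def by (simp add: linear_scale[OF D_linear[OF assms]] mult.commute[of _ "D _ _"])
qed

text \<open>
  The mixed second difference of \<open>f\<close> is \<open>t\<^sup>2 B v u\<close> up to \<open>o(t\<^sup>2)\<close>, by the mean value theorem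
  applied to the increment in direction \<open>v\<close> along the segment in direction \<open>u\<close>.  Exchanging \<open>u\<close> and
  \<open>v\<close> leaves the second difference unchanged, and this makes the second derivative symmetric.
\<close>

lemma second_difference_bound:
  fixes u v :: 'a
  assumes \<epsilon>: "\<epsilon> > 0"
    and \<delta>: "\<And>x v. norm x < \<delta> \<Longrightarrow> a + x \<in> S \<and> \<bar>D (a + x) v - D a v - B x v\<bar> \<le> \<epsilon> * norm x * norm v"
    and t: "t > 0" "t * (norm u + norm v) < \<delta>"
  shows "\<bar>f (a + t *\<^sub>R u + t *\<^sub>R v) - f (a + t *\<^sub>R u) - f (a + t *\<^sub>R v) + f a - t\<^sup>2 * B v u\<bar>
           \<le> 2 * \<epsilon> * t\<^sup>2 * (norm u + norm v)\<^sup>2"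
proof -
  have small: "norm (s *\<^sub>R u + r *\<^sub>R v) \<le> t * (norm u + norm v)"
    if "0 \<le> s" "s \<le> t" "0 \<le> r" "r \<le> t" for s r
  proof -
    have "norm (s *\<^sub>R u + r *\<^sub>R v) \<le> s * norm u + r * norm v"
      using norm_triangle_ineq[of "s *\<^sub>R u" "r *\<^sub>R v"] that by simp
    also have "\<dots> \<le> t * norm u + t * norm v"
      using that by (intro add_mono mult_right_mono) auto
    finally show ?thesis by (simp add: algebra_simps)
  qed
  define g where "g s = f ((a + t *\<^sub>R v) + s *\<^sub>R u) - f (a + s *\<^sub>R u)" for s
  have "\<exists>z>0. z < t \<and> g t - g 0 = (t - 0) * (D ((a + t *\<^sub>R v) + z *\<^sub>R u) u - D (a + z *\<^sub>R u) u)"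
    unfolding g_def
  proof (intro MVT2 DERIV_diff derivative_along_line)
    fix s assume "0 \<le> s" "s \<le> t"
    with small[of s t] small[of s 0] t \<delta>[of "s *\<^sub>R u + t *\<^sub>R v"] \<delta>[of "s *\<^sub>R u + 0 *\<^sub>R v"]
    show "(a + t *\<^sub>R v) + s *\<^sub>R u \<in> S" "a + s *\<^sub>R u \<in> S" by (auto simp: add_ac)
  qed (use t in auto)
  then obtain z where z: "0 < z" "z < t"
    and g: "g t - g 0 = t * (D (a + (z *\<^sub>R u + t *\<^sub>R v)) u - D (a + (z *\<^sub>R u + 0 *\<^sub>R v)) u)"
    by (auto simp: add_ac)
  have est: "\<bar>D (a + (z *\<^sub>R u + r *\<^sub>R v)) u - D a u - B (z *\<^sub>R u + r *\<^sub>R v) u\<bar>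
          \<le> \<epsilon> * (t * (norm u + norm v)) * (norm u + norm v)" if "0 \<le> r" "r \<le> t" for r
  proof -
    have *: "norm (z *\<^sub>R u + r *\<^sub>R v) \<le> t * (norm u + norm v)"
      using small that z by simp
    hence "\<bar>D (a + (z *\<^sub>R u + r *\<^sub>R v)) u - D a u - B (z *\<^sub>R u + r *\<^sub>R v) u\<bar>
          \<le> \<epsilon> * norm (z *\<^sub>R u + r *\<^sub>R v) * norm u"
      using \<delta>[of "z *\<^sub>R u + r *\<^sub>R v" u] t by simp
    also have "\<dots> \<le> \<epsilon> * (t * (norm u + norm v)) * (norm u + norm v)"
      using * \<epsilon> t by (intro mult_mono) auto
    finally show ?thesis .
  qed
  define E where "E r = D (a + (z *\<^sub>R u + r *\<^sub>R v)) u - D a u - B (z *\<^sub>R u + r *\<^sub>R v) u" for r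
  have BB: "B (z *\<^sub>R u + r *\<^sub>R v) u = z * B u u + r * B v u" for r
    by (simp add: linear_add[OF second_derivative_linear_left] linear_scale[OF second_derivative_linear_left])
  have "f (a + t *\<^sub>R u + t *\<^sub>R v) - f (a + t *\<^sub>R u) - f (a + t *\<^sub>R v) + f a = g t - g 0"
    by (simp add: g_def add_ac)
  also have "\<dots> = t * (t * B v u + E t - E 0)"
    unfolding g E_def BB by simp
  finally have "f (a + t *\<^sub>R u + t *\<^sub>R v) - f (a + t *\<^sub>R u) - f (a + t *\<^sub>R v) + f a - t\<^sup>2 * B v u
      = t * (E t - E 0)"
    by (simp add: algebra_simps power2_eq_square)
  hence "\<bar>f (a + t *\<^sub>R u + t *\<^sub>R v) - f (a + t *\<^sub>R u) - f (a + t *\<^sub>R v) + f a - t\<^sup>2 * B v u\<bar>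
      = t * \<bar>E t - E 0\<bar>"
    using t by (simp add: abs_mult)
  also have "\<dots> \<le> t * (2 * (\<epsilon> * (t * (norm u + norm v)) * (norm u + norm v)))"
    using est[of t] est[of 0] t unfolding E_def[symmetric] by (intro mult_left_mono) auto
  also have "\<dots> = 2 * \<epsilon> * t\<^sup>2 * (norm u + norm v)\<^sup>2"
    by (simp add: power2_eq_square algebra_simps)
  finally show ?thesis .
qed

lemma second_derivative_symmetric: "B u v = B v u"
proof (rule ccontr)
  assume neq: "B u v \<noteq> B v u"
  define K where "K = (norm u + norm v)\<^sup>2 + 1"
  have K: "K > 0" unfolding K_def by (intro add_nonneg_pos) auto
  define \<epsilon> where "\<epsilon> = \<bar>B u v - B v u\<bar> / (8 * K)"
  have \<epsilon>: "\<epsilon> > 0" using neq K by (simp add: \<epsilon>_def)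
  obtain \<delta> where "\<delta> > 0" and \<delta>: "\<And>x v. norm x < \<delta> \<Longrightarrow>
      a + x \<in> S \<and> \<bar>D (a + x) v - D a v - B x v\<bar> \<le> \<epsilon> * norm x * norm v"
    by (rule derivative_expansion[OF \<epsilon>]) blast
  define t where "t = \<delta> / (norm u + norm v + 1)"
  have nn: "norm u + norm v + 1 > 0" by (intro add_nonneg_pos) auto
  have t: "t > 0" "t * (norm u + norm v) < \<delta>"
    using \<open>\<delta> > 0\<close> nn by (auto simp: t_def field_simps)
  define Q where "Q = f (a + t *\<^sub>R u + t *\<^sub>R v) - f (a + t *\<^sub>R u) - f (a + t *\<^sub>R v) + f a"
  have "\<bar>Q - t\<^sup>2 * B v u\<bar> \<le> 2 * \<epsilon> * t\<^sup>2 * (norm u + norm v)\<^sup>2"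
    unfolding Q_def by (rule second_difference_bound[OF \<epsilon> \<delta> t])
  moreover have "\<bar>Q - t\<^sup>2 * B u v\<bar> \<le> 2 * \<epsilon> * t\<^sup>2 * (norm u + norm v)\<^sup>2"
    using second_difference_bound[OF \<epsilon> \<delta>, where t = t and u = v and v = u] t unfolding Q_def by (simp add: add_ac diff_diff_eq)
  ultimately have "\<bar>t\<^sup>2 * B u v - t\<^sup>2 * B v u\<bar> \<le> 4 * \<epsilon> * t\<^sup>2 * (norm u + norm v)\<^sup>2" by linarith
  moreover have "\<bar>t\<^sup>2 * B u v - t\<^sup>2 * B v u\<bar> = t\<^sup>2 * \<bar>B u v - B v u\<bar>"
    unfolding right_diff_distrib[symmetric] by (simp add: abs_mult)
  ultimately have "t\<^sup>2 * \<bar>B u v - B v u\<bar> \<le> t\<^sup>2 * (4 * \<epsilon> * (norm u + norm v)\<^sup>2)"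
    by (simp add: mult_ac)
  hence "\<bar>B u v - B v u\<bar> \<le> 4 * \<epsilon> * (norm u + norm v)\<^sup>2" using t by simp
  also have "\<dots> < 4 * \<epsilon> * K" using \<epsilon> by (simp add: K_def)
  also have "\<dots> = \<bar>B u v - B v u\<bar> / 2" using K by (simp add: \<epsilon>_def)
  finally show False using neq by simp
qed

lemma second_order_taylor:
  assumes \<epsilon>: "\<epsilon> > 0"
  obtains \<delta> where "\<delta> > 0"
    "\<And>v. norm v < \<delta> \<Longrightarrow> a + v \<in> S \<and> \<bar>f (a + v) - f a - D a v - B v v / 2\<bar> \<le> \<epsilon> * (norm v)\<^sup>2"
proof -
  obtain \<delta> where "\<delta> > 0" and \<delta>: "\<And>x v. norm x < \<delta> \<Longrightarrow>
      a + x \<in> S \<and> \<bar>D (a + x) v - D a v - B x v\<bar> \<le> \<epsilon> * norm x * norm v"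
    by (rule derivative_expansion[OF \<epsilon>]) blast
  show thesis
  proof (rule that[OF \<open>\<delta> > 0\<close>])
    fix v :: 'a assume v: "norm v < \<delta>"
    have tv: "norm (t *\<^sub>R v) < \<delta>" "norm (t *\<^sub>R v) \<le> norm v" if "0 \<le> t" "t \<le> 1" for t
    proof -
      show "norm (t *\<^sub>R v) \<le> norm v" using that by (simp add: mult_left_le_one_le)
      thus "norm (t *\<^sub>R v) < \<delta>" using v by linarith
    qed
    define g where "g t = f (a + t *\<^sub>R v) - t * D a v - t\<^sup>2 * (B v v / 2)" for t
    have "\<exists>z>0. z < 1 \<and> g 1 - g 0 = (1 - 0) * (D (a + z *\<^sub>R v) v - D a v - z * B v v)"
      unfolding g_def
    proof (rule MVT2)
      fix t :: real assume "0 \<le> t" "t \<le> 1"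
      hence "a + t *\<^sub>R v \<in> S" using \<delta> tv by blast
      from derivative_along_line[OF this]
      show "((\<lambda>t. f (a + t *\<^sub>R v) - t * D a v - t\<^sup>2 * (B v v / 2)) has_real_derivative
               D (a + t *\<^sub>R v) v - D a v - t * B v v) (at t)"
        by (auto intro!: derivative_eq_intros)
    qed auto
    then obtain z where z: "0 < z" "z < 1" and g: "g 1 - g 0 = D (a + z *\<^sub>R v) v - D a v - z * B v v"
      by auto
    have Bz: "B (z *\<^sub>R v) v = z * B v v"
      by (simp add: linear_scale[OF second_derivative_linear_left])
    have "\<bar>f (a + v) - f a - D a v - B v v / 2\<bar> = \<bar>g 1 - g 0\<bar>" by (simp add: g_def)
    also have "\<dots> \<le> \<epsilon> * norm (z *\<^sub>R v) * norm v"
      using \<delta>[of "z *\<^sub>R v" v] tv(1)[of z] z unfolding g Bz by simp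
    also have "\<dots> \<le> \<epsilon> * norm v * norm v"
      using tv(2)[of z] z \<epsilon> by (intro mult_mono) auto
    finally show "a + v \<in> S \<and> \<bar>f (a + v) - f a - D a v - B v v / 2\<bar> \<le> \<epsilon> * (norm v)\<^sup>2"
      using \<delta> v by (simp add: power2_eq_square mult.assoc)
  qed
qed

end

section \<open>The complex Hessian in the Taylor expansion\<close>

text \<open>
  Let \<open>B\<close> be the real second derivative at \<open>a\<close> and \<open>J\<close> multiplication by \<open>\<i>\<close>.  Then
  \<open>B(v,v)/2 = S(v,v) + Re T(v,v)\<close>, where \<open>S\<close> is sesquilinear and \<open>T\<close> is complex
  bilinear.  The matrix of \<open>S\<close> is the complex Hessian, and \<open>T\<close> together with the complex linear \<open>l\<close>, whose
  real part is the first derivative, makes up the holomorphic polynomial \<open>h\<close>.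
\<close>

lemma levi_expansion:
  fixes \<phi> :: "complex^'n \<Rightarrow> real" and \<Omega> :: "(complex^'n) set"
  assumes \<Omega>: "open \<Omega>" "a \<in> \<Omega>" and C2: "Ck_on 2 \<phi> \<Omega>"
  defines "H \<equiv> complex_hessian \<phi> a"
  shows "H $ k $ j = cnj (H $ j $ k)"
    and "\<exists>h. holomorphic_Cn_on h UNIV \<and> h 0 = 0 \<and>
      (\<forall>\<epsilon>>0. \<exists>\<delta>>0. \<forall>v. norm v < \<delta> \<longrightarrow> a + v \<in> \<Omega> \<and>
        \<bar>\<phi> (a + v) - \<phi> a - Re (h v)
            - Re (\<Sum>j\<in>UNIV. \<Sum>k\<in>UNIV. H $ j $ k * v $ j * cnj (v $ k))\<bar> \<le> \<epsilon> * (norm v)\<^sup>2)"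
proof -
  define D where "D = (\<lambda>x. frechet_derivative \<phi> (at x))"
  define B where "B = second_derivative \<phi> a"
  define J where "J v = \<i> *s v" for v :: "complex^'n"
  have D: "(\<phi> has_derivative D x) (at x)" if "x \<in> \<Omega>" for x
    unfolding D_def by (rule C2_on_has_derivatives[OF C2 that])
  have B: "((\<lambda>x. D x v) has_derivative (\<lambda>u. B u v)) (at a)" for v
    unfolding D_def B_def second_derivative_def
    using C2_on_has_derivatives(2)[OF C2 \<Omega>(2), of v] by simp
  have Dlin: "linear (D a)" using D[OF \<Omega>(2)] has_derivative_linear by blast
  have BL: "linear (\<lambda>u. B u v)" for v
    unfolding B_def by (rule second_derivative_linear_left[OF \<Omega> C2])
  have BR: "linear (B u)" for u
    unfolding B_def by (rule second_derivative_linear_right[OF \<Omega> C2])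
  have sym: "B u v = B v u" for u v
    unfolding B_def by (rule second_derivative_symmetric[OF \<Omega> C2])
  have smult: "c *s v = Re c *\<^sub>R v + Im c *\<^sub>R J v" for c v
    by (simp add: J_def vec_eq_iff complex_eq_iff)
  have J_smult: "J (c *s v) = Re c *\<^sub>R J v - Im c *\<^sub>R v" for c v
    by (simp add: J_def vec_eq_iff complex_eq_iff)
  have J_add: "J (u + v) = J u + J v" for u v by (simp add: J_def vec_eq_iff algebra_simps)
  have JJ: "J (J v) = - v" for v by (simp add: J_def vec_eq_iff)
  note Bs = linear_add[OF BL] linear_add[OF BR] linear_diff[OF BL] linear_diff[OF BR]
            linear_scale[OF BL] linear_scale[OF BR] linear_neg[OF BL] linear_neg[OF BR]
  define S where "S u v = (of_real (B u v + B (J u) (J v))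
                       + \<i> * of_real (B u (J v) - B (J u) v)) / 4" for u v
  define T where "T u v = (of_real (B u v - B (J u) (J v))
                       - \<i> * of_real (B (J u) v + B u (J v))) / 4" for u v
  define l where "l v = of_real (D a v) - \<i> * of_real (D a (J v))" for v
  have S_add: "S (u + v) w = S u w + S v w" "S w (u + v) = S w u + S w v" for u v w
    by (simp_all add: S_def J_add Bs complex_eq_iff field_simps)
  have S_smult: "S (c *s u) v = c * S u v" "S u (c *s v) = cnj c * S u v" for c u v
    unfolding S_def J_smult unfolding smult
    by (simp_all add: Bs complex_eq_iff field_simps)
  have S_zero: "S 0 v = 0" "S u 0 = 0" for u v using S_smult(1)[where c=0 and u=0] S_smult(2)[where c=0 and v=0] by simp_all
  have T_add: "T (u + v) w = T u w + T v w" "T w (u + v) = T w u + T w v" for u v w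
    by (simp_all add: T_def J_add Bs complex_eq_iff field_simps)
  have T_smult: "T (c *s u) v = c * T u v" "T u (c *s v) = c * T u v" for c u v
    unfolding T_def J_smult unfolding smult
    by (simp_all add: Bs complex_eq_iff field_simps)
  have l_smult: "l (c *s v) = c * l v" for c v
    unfolding l_def J_smult unfolding smult
    by (simp add: linear_add[OF Dlin] linear_diff[OF Dlin] linear_scale[OF Dlin] complex_eq_iff field_simps)
  have J_axis: "J (axis k 1) = axis k \<i>" for k
    by (simp add: J_def vec_eq_iff axis_def)
  have H: "H $ j $ k = S (axis j 1) (axis k 1)" for j k
  proof -
    have 1: "dzbar k (\<lambda>w. complex_of_real (\<phi> w)) w
        = (of_real (D w (axis k 1)) + \<i> * of_real (D w (axis k \<i>))) / 2" if "w \<in> \<Omega>" for w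
    proof -
      have "((\<lambda>w. complex_of_real (\<phi> w)) has_derivative (\<lambda>v. of_real (D w v))) (at w)"
        by (intro has_derivative_of_real D that)
      from frechet_derivative_at[OF this, symmetric] show ?thesis by (simp add: dzbar_def)
    qed
    have "((\<lambda>w. (complex_of_real (D w (axis k 1)) + \<i> * of_real (D w (axis k \<i>))) / 2) has_derivative
           (\<lambda>u. (of_real (B u (axis k 1)) + \<i> * of_real (B u (axis k \<i>))) / 2)) (at a)"
      by (intro bounded_linear.has_derivative[OF bounded_linear_divide] has_derivative_add
                has_derivative_mult_right has_derivative_of_real B)
    hence "(dzbar k (\<lambda>w. complex_of_real (\<phi> w)) has_derivative
           (\<lambda>u. (of_real (B u (axis k 1)) + \<i> * of_real (B u (axis k \<i>))) / 2)) (at a)"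
      by (rule has_derivative_transform_within_open[OF _ \<Omega>]) (simp add: 1)
    from frechet_derivative_at[OF this, symmetric] show ?thesis
      unfolding H_def complex_hessian_def S_def dz_def J_axis
      by (simp add: complex_eq_iff field_simps)
  qed
  show "H $ k $ j = cnj (H $ j $ k)"
    unfolding H S_def
    using sym[of "axis k 1" "axis j 1"] sym[of "J (axis k 1)" "J (axis j 1)"]
          sym[of "J (axis k 1)" "axis j 1"] sym[of "axis k 1" "J (axis j 1)"]
    by (simp add: complex_eq_iff)
  have S_vv: "S v v = of_real ((B v v + B (J v) (J v)) / 4)" for v
    using sym[of "J v" v] by (simp add: S_def)
  have S_sum: "S v v = (\<Sum>j\<in>UNIV. \<Sum>k\<in>UNIV. H $ j $ k * v $ j * cnj (v $ k))" for v
  proof -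
    have sum1: "S (\<Sum>j\<in>A. g j) w = (\<Sum>j\<in>A. S (g j) w)" for g w and A :: "'n set"
      by (induction A rule: infinite_finite_induct) (auto simp: S_add S_zero)
    have sum2: "S w (\<Sum>j\<in>A. g j) = (\<Sum>j\<in>A. S w (g j))" for g w and A :: "'n set"
      by (induction A rule: infinite_finite_induct) (auto simp: S_add S_zero)
    have "S v v = S (\<Sum>j\<in>UNIV. v $ j *s axis j 1) (\<Sum>k\<in>UNIV. v $ k *s axis k 1)"
      by (simp add: basis_expansion)
    also have "\<dots> = (\<Sum>j\<in>UNIV. S (v $ j *s axis j 1) (\<Sum>k\<in>UNIV. v $ k *s axis k 1))"
      by (rule sum1)
    also have "\<dots> = (\<Sum>j\<in>UNIV. \<Sum>k\<in>UNIV. v $ j * (cnj (v $ k) * S (axis j 1) (axis k 1)))"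
      by (simp only: sum2 S_smult) (intro sum.cong refl mult.left_commute)
    finally show ?thesis by (simp add: H mult_ac)
  qed
  define h where "h v = l v + T v v" for v
  have "holomorphic_Cn_on h UNIV"
    unfolding holomorphic_Cn_on_def
  proof
    fix z
    have "bilinear T"
      unfolding bilinear_def
    proof (intro conjI allI linearI)
      fix c u v
      show "T (c *\<^sub>R u) v = c *\<^sub>R T u v" "T u (c *\<^sub>R v) = c *\<^sub>R T u v"
        by (simp_all add: scaleR_eq_smult T_smult scaleR_conv_of_real)
    qed (simp_all add: T_add)
    hence bb: "bounded_bilinear T" by (simp add: bilinear_conv_bounded_bilinear)
    have "linear l"
      by (rule linearI)
         (simp_all add: scaleR_eq_smult l_smult scaleR_conv_of_real,
          simp add: l_def J_add linear_add[OF Dlin] algebra_simps)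
    hence "(l has_derivative l) (at z)"
      by (intro bounded_linear_imp_has_derivative) (simp add: linear_conv_bounded_linear)
    hence "(h has_derivative (\<lambda>w. l w + (T z w + T w z))) (at z)"
      unfolding h_def
      by (intro has_derivative_add bounded_bilinear.FDERIV[OF bb] has_derivative_ident)
    moreover have "l (c *s v) + (T z (c *s v) + T (c *s v) z) = c * (l v + (T z v + T v z))" for c v
      by (simp add: l_smult T_smult algebra_simps)
    ultimately show "\<exists>D. (h has_derivative D) (at z) \<and> (\<forall>c v. D (c *s v) = c * D v)" by blast
  qed
  moreover have "h 0 = 0" using l_smult[where c=0 and v=0] T_smult(1)[where c=0 and u=0 and v=0] by (simp add: h_def)
  moreover have "\<exists>\<delta>>0. \<forall>v. norm v < \<delta> \<longrightarrow> a + v \<in> \<Omega> \<and>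
        \<bar>\<phi> (a + v) - \<phi> a - Re (h v)
            - Re (\<Sum>j\<in>UNIV. \<Sum>k\<in>UNIV. H $ j $ k * v $ j * cnj (v $ k))\<bar> \<le> \<epsilon> * (norm v)\<^sup>2"
    if eps: "\<epsilon> > 0" for \<epsilon>
  proof -
    obtain \<delta> where "\<delta> > 0" and \<delta>: "\<And>v. norm v < \<delta> \<Longrightarrow>
        a + v \<in> \<Omega> \<and> \<bar>\<phi> (a + v) - \<phi> a - D a v - B v v / 2\<bar> \<le> \<epsilon> * (norm v)\<^sup>2"
      unfolding B_def D_def by (rule second_order_taylor[OF \<Omega> C2 eps]) blast
    have "Re (h v) + Re (S v v) = D a v + B v v / 2" for v
      unfolding S_vv by (simp add: h_def l_def T_def field_simps)
    hence eq: "\<phi> (a + v) - \<phi> a - Re (h v) - Re (S v v) = \<phi> (a + v) - \<phi> a - D a v - B v v / 2" for v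
      by (smt (verit))
    show ?thesis unfolding S_sum[symmetric] eq using \<open>\<delta> > 0\<close> \<delta> by blast
  qed
  ultimately show "\<exists>h. holomorphic_Cn_on h UNIV \<and> h 0 = 0 \<and>
      (\<forall>\<epsilon>>0. \<exists>\<delta>>0. \<forall>v. norm v < \<delta> \<longrightarrow> a + v \<in> \<Omega> \<and>
        \<bar>\<phi> (a + v) - \<phi> a - Re (h v)
            - Re (\<Sum>j\<in>UNIV. \<Sum>k\<in>UNIV. H $ j $ k * v $ j * cnj (v $ k))\<bar> \<le> \<epsilon> * (norm v)\<^sup>2)"
    by blast
qed

section \<open>Bi-balls\<close>

lemma card_first_coords:
  assumes "q \<le> CARD('n)"
  shows "card (first_coords q :: 'n::{finite,linorder} set) = q"
proof -
  define rk where "rk i = card {j::'n. j < i}" for i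
  have less: "rk i < rk j" if "i < j" for i j
    unfolding rk_def using that by (intro psubset_card_mono) auto
  have inj: "inj rk" by (rule linorder_injI) (use less in force)
  have "rk i < CARD('n)" for i unfolding rk_def by (intro psubset_card_mono) auto
  hence "range rk = {..<CARD('n)}"
    using inj by (intro card_subset_eq) (auto simp: card_image)
  hence "rk ` first_coords q = {..<q}"
    using assms unfolding first_coords_def rk_def[symmetric] by auto
  thus ?thesis using card_image[OF inj_on_subset[OF inj, of "first_coords q"]] by simp
qed

definition coord_biball :: "'n set \<Rightarrow> real \<Rightarrow> real \<Rightarrow> (complex^'n) set" where
  "coord_biball I r s = {z. L2_set (\<lambda>i. cmod (z $ i)) I < r \<and> L2_set (\<lambda>i. cmod (z $ i)) (- I) < s}"

lemma biball_eq: "biball q r s A = (*v) A ` coord_biball (first_coords q) r s"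
  by (simp add: biball_def coord_biball_def)

lemma open_coord_biball: "open (coord_biball I r s)"
  unfolding coord_biball_def L2_set_def
  by (intro open_Collect_conj open_Collect_less continuous_intros)

lemma zero_in_coord_biball: "r > 0 \<Longrightarrow> s > 0 \<Longrightarrow> 0 \<in> coord_biball I r s"
  by (simp add: coord_biball_def L2_set_def)

lemma norm_coord_biball:
  assumes "z \<in> coord_biball I r s"
  shows "norm z < r + s"
proof -
  have "norm z = sqrt ((\<Sum>i\<in>I. (cmod (z $ i))\<^sup>2) + (\<Sum>i\<in>-I. (cmod (z $ i))\<^sup>2))"
    unfolding norm_vec_def L2_set_def by (subst sum.union_disjoint[symmetric]) (auto simp: Compl_partition)
  also have "\<dots> \<le> L2_set (\<lambda>i. cmod (z $ i)) I + L2_set (\<lambda>i. cmod (z $ i)) (- I)"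
    unfolding L2_set_def by (intro sqrt_add_le_add_sqrt sum_nonneg) auto
  finally show ?thesis using assms by (simp add: coord_biball_def)
qed

lemma bounded_coord_biball: "bounded (coord_biball I r s)"
  unfolding bounded_iff by (intro exI[of _ "r + s"]) (use norm_coord_biball less_imp_le in blast)

lemma coord_biball_balanced:
  assumes "z \<in> coord_biball I r s" "cmod c \<le> 1"
  shows "c *s z \<in> coord_biball I r s"
proof -
  have "L2_set (\<lambda>i. cmod ((c *s z) $ i)) X \<le> L2_set (\<lambda>i. cmod (z $ i)) X" for X
    using assms(2) by (intro L2_set_mono) (auto simp: norm_mult mult_left_le_one_le)
  with assms(1) show ?thesis unfolding coord_biball_def by (auto intro: le_less_trans)
qed

lemma biball_props:
  assumes "unitary_matrix A"
  shows "open (biball q r s A)" "bounded (biball q r s A)"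
    and "0 < r \<Longrightarrow> 0 < s \<Longrightarrow> 0 \<in> biball q r s A"
    and "\<And>z c. z \<in> biball q r s A \<Longrightarrow> cmod c \<le> 1 \<Longrightarrow> c *s z \<in> biball q r s A"
    and "\<And>z. z \<in> biball q r s A \<Longrightarrow> norm z < r + s"
proof -
  have A: "orthogonal_transformation ((*v) A)"
    using assms by (rule unitary_matrix_orthogonal_transformation)
  show "open (biball q r s A)"
    unfolding biball_eq
    by (intro open_surjective_linear_image open_coord_biball orthogonal_transformation_linear A
              orthogonal_transformation_surj)
  show norm: "norm z < r + s" if "z \<in> biball q r s A" for z
    using that norm_coord_biball orthogonal_transformation_norm[OF A] unfolding biball_eq by auto
  show "bounded (biball q r s A)"
    unfolding bounded_iff by (intro exI[of _ "r + s"]) (use norm less_imp_le in blast)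
  show "0 \<in> biball q r s A" if "0 < r" "0 < s"
    unfolding biball_eq using zero_in_coord_biball[OF that]
    by (intro image_eqI[of _ _ 0]) auto
  show "c *s z \<in> biball q r s A" if "z \<in> biball q r s A" "cmod c \<le> 1" for z c
  proof -
    obtain w where w: "w \<in> coord_biball (first_coords q) r s" "z = A *v w"
      using \<open>z \<in> biball q r s A\<close> unfolding biball_eq by auto
    have "c *s z = A *v (c *s w)"
      unfolding w by (simp add: vec_eq_iff matrix_vector_mult_def sum_distrib_left mult_ac)
    thus ?thesis using coord_biball_balanced[OF w(1) that(2)] unfolding biball_eq by auto
  qed
qed

lemma set_integrable_continuous_bounded:
  fixes F :: "'a::euclidean_space \<Rightarrow> real"
  assumes "continuous_on UNIV F" "bounded P" "P \<in> sets borel"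
  shows "set_integrable lborel P F"
proof (rule set_integrable_subset)
  show "set_integrable lborel (closure P) F"
    unfolding set_integrable_def
    using assms by (intro borel_integrable_compact) (auto intro: continuous_on_subset)
qed (use assms closure_subset in auto)

lemma measure_open_pos:
  assumes "open P" "bounded P" "P \<noteq> {}"
  shows "measure lborel P > 0"
proof -
  have "emeasure lborel P < \<infinity>" using assms by (intro emeasure_bounded_finite)
  moreover have "emeasure lborel P \<noteq> 0"
  proof
    assume "emeasure lborel P = 0"
    hence "negligible P"
      using assms by (auto simp: negligible_iff_null_sets null_sets_completion_iff intro!: null_setsI)
    thus False using open_not_negligible assms by blast
  qed
  ultimately show ?thesis by (simp add: measure_def enn2real_positive_iff top.not_eq_extremum zero_less_iff_neq_zero)
qed

section \<open>A lower bound for the extension index\<close>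

lemma weighted_L2_translate:
  fixes P :: "(complex^'n) set"
  assumes "open P" "continuous_on ((+) a ` P) \<phi>" "continuous_on ((+) a ` P) \<sigma>"
  shows "weighted_L2 \<phi> ((+) a ` P) \<sigma>
       = (\<integral>\<^sup>+v. ennreal (indicator P v *\<^sub>R ((cmod (\<sigma> (a + v)))\<^sup>2 * exp (- \<phi> (a + v)))) \<partial>lborel)"
proof -
  define X where "X = (+) a ` P"
  have X: "X \<in> sets borel" using assms(1) unfolding X_def by (intro borel_open open_translation)
  have "(\<lambda>z. indicator X z *\<^sub>R ((cmod (\<sigma> z))\<^sup>2 * exp (- \<phi> z))) \<in> borel_measurable borel"
    using X assms(2,3) unfolding X_def
    by (intro borel_measurable_continuous_on_indicator continuous_intros) auto
  hence m: "(\<lambda>z. ennreal (indicator X z *\<^sub>R ((cmod (\<sigma> z))\<^sup>2 * exp (- \<phi> z)))) \<in> borel_measurable borel"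
    by measurable
  have "weighted_L2 \<phi> X \<sigma>
      = (\<integral>\<^sup>+z. ennreal (indicator X z *\<^sub>R ((cmod (\<sigma> z))\<^sup>2 * exp (- \<phi> z))) \<partial>lborel)"
    unfolding weighted_L2_def by (intro nn_integral_cong) (auto split: split_indicator)
  also have "\<dots> = (\<integral>\<^sup>+z. ennreal (indicator X z *\<^sub>R ((cmod (\<sigma> z))\<^sup>2 * exp (- \<phi> z))) \<partial>distr lborel borel ((+) a))"
    by (simp add: lborel_distr_plus)
  also have "\<dots> = (\<integral>\<^sup>+v. ennreal (indicator X (a + v) *\<^sub>R ((cmod (\<sigma> (a + v)))\<^sup>2 * exp (- \<phi> (a + v)))) \<partial>lborel)"
    using m by (intro nn_integral_distr) auto
  also have "(\<lambda>v. indicator X (a + v) :: real) = indicator P"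
    by (auto simp: X_def indicator_def fun_eq_iff)
  finally show ?thesis unfolding X_def .
qed

lemma holomorphic_Cn_on_twist:
  assumes "holomorphic_Cn_on \<sigma> ((+) a ` P)" "holomorphic_Cn_on h UNIV"
  shows "holomorphic_Cn_on (\<lambda>v. \<sigma> (a + v) * exp (- h v / 2)) P"
  unfolding holomorphic_Cn_on_def
proof
  fix z assume "z \<in> P"
  obtain D where D: "(\<sigma> has_derivative D) (at (a + z))" "\<And>c v. D (c *s v) = c * D v"
    using assms(1) \<open>z \<in> P\<close> unfolding holomorphic_Cn_on_def by blast
  obtain E where E: "(h has_derivative E) (at z)" "\<And>c v. E (c *s v) = c * E v"
    using assms(2) unfolding holomorphic_Cn_on_def by blast
  have 1: "((\<lambda>v. \<sigma> (a + v)) has_derivative D) (at z)"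
    by (rule has_derivative_compose[of "\<lambda>v. a + v" "\<lambda>v. v" z UNIV \<sigma> D])
       (auto intro!: derivative_eq_intros D(1))
  have 2: "((\<lambda>v. - h v / 2) has_derivative (\<lambda>v. - E v / 2)) (at z)"
    by (intro bounded_linear.has_derivative[OF bounded_linear_divide] has_derivative_minus E)
  have "(exp has_derivative (\<lambda>y. exp (- h z / 2) * y)) (at (- h z / 2))"
    using DERIV_exp[of "- h z / 2"] by (simp add: has_field_derivative_def)
  from has_derivative_compose[OF 2 this]
  have 3: "((\<lambda>v. exp (- h v / 2)) has_derivative (\<lambda>v. exp (- h z / 2) * (- E v / 2))) (at z)" .
  have "((\<lambda>v. \<sigma> (a + v) * exp (- h v / 2)) has_derivative
          (\<lambda>v. \<sigma> (a + z) * (exp (- h z / 2) * (- E v / 2)) + D v * exp (- h z / 2))) (at z)"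
    by (rule has_derivative_mult[OF 1 3])
  moreover have "\<sigma> (a + z) * (exp (- h z / 2) * (- E (c *s v) / 2)) + D (c *s v) * exp (- h z / 2)
     = c * (\<sigma> (a + z) * (exp (- h z / 2) * (- E v / 2)) + D v * exp (- h z / 2))" for c v
    by (simp add: D(2) E(2) algebra_simps)
  ultimately show "\<exists>F. ((\<lambda>v. \<sigma> (a + v) * exp (- h v / 2)) has_derivative F) (at z) \<and>
      (\<forall>c v. F (c *s v) = c * F v)" by blast
qed

text \<open>
  Here \<open>2 |f| \<le> x + y\<close> with \<open>x = |\<sigma>|\<^sup>2 e\<^bsup>\<phi>(a) - \<phi>\<^esup>\<close> and \<open>y = e\<^bsup>\<phi> - \<phi>(a) - Re h\<^esup>\<close>, because
  \<open>f = \<sigma> e\<^bsup>-h/2\<^esup>\<close> satisfies \<open>|f|\<^sup>2 = x y\<close>.  The same inequality shows that \<open>f\<close> is integrable, so that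
  the mean value property applies to it.
\<close>

lemma weighted_L2_lower_bound:
  fixes P :: "(complex^'n) set"
  assumes P: "open P" "bounded P" "0 \<in> P" "\<And>z c. z \<in> P \<Longrightarrow> cmod c \<le> 1 \<Longrightarrow> c *s z \<in> P"
    and \<phi>: "continuous_on ((+) a ` P) \<phi>"
    and h: "holomorphic_Cn_on h UNIV" "h 0 = 0"
    and G: "set_integrable lborel P G" "\<And>v. v \<in> P \<Longrightarrow> exp (\<phi> (a + v) - \<phi> a - Re (h v)) \<le> G v"
    and \<sigma>: "holomorphic_Cn_on \<sigma> ((+) a ` P)" "\<sigma> a = 1" and fin: "weighted_L2 \<phi> ((+) a ` P) \<sigma> < \<infinity>"
  shows "weighted_L2 \<phi> ((+) a ` P) \<sigma>
           \<ge> ennreal (exp (- \<phi> a) * (2 * measure lborel P - set_lebesgue_integral lborel P G))"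
proof -
  define g where "g v = (cmod (\<sigma> (a + v)))\<^sup>2 * exp (- \<phi> (a + v))" for v
  define f where "f v = \<sigma> (a + v) * exp (- h v / 2)" for v
  have Pb: "P \<in> sets borel" using P(1) by simp
  have \<sigma>c: "continuous_on ((+) a ` P) \<sigma>"
    using \<sigma>(1) by (rule holomorphic_Cn_on_imp_continuous_on)
  have W: "weighted_L2 \<phi> ((+) a ` P) \<sigma> = (\<integral>\<^sup>+v. ennreal (indicator P v *\<^sub>R g v) \<partial>lborel)"
    unfolding g_def by (rule weighted_L2_translate[OF P(1) \<phi> \<sigma>c])
  have tr: "continuous_on P (\<lambda>v. k (a + v))" if "continuous_on ((+) a ` P) k" for k :: "_ \<Rightarrow> 'b::topological_space"
    by (rule continuous_on_compose2[OF that]) (auto intro!: continuous_intros)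
  have gm: "(\<lambda>v. indicator P v *\<^sub>R g v) \<in> borel_measurable lborel"
  proof -
    have "continuous_on P g" unfolding g_def by (intro continuous_intros tr \<phi> \<sigma>c)
    from borel_measurable_continuous_on_indicator[OF Pb this] show ?thesis by simp
  qed
  have gi: "set_integrable lborel P g"
    unfolding set_integrable_def
  proof (rule integrableI_nonneg[OF gm])
    show "(\<integral>\<^sup>+v. ennreal (indicator P v *\<^sub>R g v) \<partial>lborel) < \<infinity>" using fin unfolding W .
  qed (simp add: g_def)
  have W': "weighted_L2 \<phi> ((+) a ` P) \<sigma> = ennreal (set_lebesgue_integral lborel P g)"
    unfolding W set_lebesgue_integral_def
    using gi unfolding set_integrable_def by (intro nn_integral_eq_integral) (auto simp: g_def)
  have fh: "holomorphic_Cn_on f P"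
    unfolding f_def using \<sigma>(1) h(1) by (rule holomorphic_Cn_on_twist)
  have bound: "2 * cmod (f v) \<le> exp (\<phi> a) * g v + G v" if "v \<in> P" for v
  proof -
    define x where "x = exp (\<phi> a) * g v"
    define y where "y = exp (\<phi> (a + v) - \<phi> a - Re (h v))"
    have "x * y = (cmod (\<sigma> (a + v)))\<^sup>2 * (exp (\<phi> a) * exp (- \<phi> (a + v)) * exp (\<phi> (a + v) - \<phi> a - Re (h v)))"
      unfolding x_def y_def g_def by (simp add: mult_ac)
    also have "exp (\<phi> a) * exp (- \<phi> (a + v)) * exp (\<phi> (a + v) - \<phi> a - Re (h v)) = exp (- Re (h v) / 2) ^ 2"
      by (simp add: exp_add[symmetric] power2_eq_square)
    finally have xy: "x * y = (cmod (f v))\<^sup>2"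
      by (simp add: f_def norm_mult power_mult_distrib)
    have "(2 * cmod (f v))\<^sup>2 = 4 * (x * y)" unfolding xy by (simp add: power_mult_distrib)
    also have "\<dots> \<le> (x + y)\<^sup>2"
      using zero_le_power2[of "x - y"] by (simp add: power2_eq_square algebra_simps)
    finally have "2 * cmod (f v) \<le> x + y"
      by (rule power2_le_imp_le) (simp add: x_def y_def g_def)
    also have "y \<le> G v" unfolding y_def by (rule G(2)[OF that])
    finally show ?thesis unfolding x_def by simp
  qed
  have egi: "set_integrable lborel P (\<lambda>v. exp (\<phi> a) * g v + G v)"
    using gi G(1) by (intro set_integral_add) auto
  have fi: "set_integrable lborel P f"
    unfolding set_integrable_def
  proof (rule Bochner_Integration.integrable_bound[OF egi[unfolded set_integrable_def]])
    show "(\<lambda>v. indicator P v *\<^sub>R f v) \<in> borel_measurable lborel"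
      using borel_measurable_continuous_on_indicator[OF Pb holomorphic_Cn_on_imp_continuous_on[OF fh]] by simp
    have "cmod (f v) \<le> norm (exp (\<phi> a) * g v + G v)" if "v \<in> P" for v
      using bound[OF that] by simp
    thus "AE v in lborel. norm (indicator P v *\<^sub>R f v) \<le> norm (indicator P v *\<^sub>R (exp (\<phi> a) * g v + G v))"
      by (intro AE_I2) (auto simp: indicator_def)
  qed
  have "set_lebesgue_integral lborel P f = measure lborel P * f 0"
    using P by (intro mean_value_balanced fh fi emeasure_bounded_finite) auto
  also have "f 0 = 1" by (simp add: f_def h \<sigma>)
  finally have mv: "set_lebesgue_integral lborel P f = measure lborel P" by simp
  have "2 * measure lborel P = 2 * Re (set_lebesgue_integral lborel P f)" by (simp add: mv)
  also have "\<dots> = (\<integral>v. indicator P v *\<^sub>R (2 * Re (f v)) \<partial>lborel)"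
    using fi unfolding set_lebesgue_integral_def set_integrable_def
    by (simp flip: integral_Re integral_mult_right_zero add: mult_ac)
  also have "\<dots> \<le> (\<integral>v. indicator P v *\<^sub>R (exp (\<phi> a) * g v + G v) \<partial>lborel)"
  proof (rule integral_mono)
    show "integrable lborel (\<lambda>v. indicator P v *\<^sub>R (2 * Re (f v)))"
      using integrable_mult_right[OF integrable_Re[OF fi[unfolded set_integrable_def]], of 2]
      by (simp add: mult_ac)
    show "integrable lborel (\<lambda>v. indicator P v *\<^sub>R (exp (\<phi> a) * g v + G v))"
      using egi unfolding set_integrable_def .
    fix v
    have "2 * Re (f v) \<le> exp (\<phi> a) * g v + G v" if "v \<in> P"
      using bound[OF that] complex_Re_le_cmod[of "f v"] by linarith
    thus "indicator P v *\<^sub>R (2 * Re (f v)) \<le> indicator P v *\<^sub>R (exp (\<phi> a) * g v + G v)"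
      by (simp add: indicator_def)
  qed
  also have "\<dots> = exp (\<phi> a) * set_lebesgue_integral lborel P g + set_lebesgue_integral lborel P G"
    using set_integral_add(2)[of lborel P "\<lambda>v. exp (\<phi> a) * g v" G] gi G(1)
    unfolding set_lebesgue_integral_def[symmetric] by simp
  finally have "2 * measure lborel P - set_lebesgue_integral lborel P G
      \<le> exp (\<phi> a) * set_lebesgue_integral lborel P g" by simp
  hence "exp (- \<phi> a) * (2 * measure lborel P - set_lebesgue_integral lborel P G)
      \<le> exp (- \<phi> a) * (exp (\<phi> a) * set_lebesgue_integral lborel P g)"
    by (intro mult_left_mono) auto
  also have "\<dots> = set_lebesgue_integral lborel P g" by (simp add: mult.assoc[symmetric] exp_minus)
  finally show ?thesis unfolding W' by (rule ennreal_leI)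
qed

text \<open>
  If \<open>G\<close> had mean less than \<open>1\<close>, the lower bound \<open>2\<close> minus that mean would hold uniformly in \<open>\<sigma>\<close>, and
  the infimum would exceed \<open>1\<close>.
\<close>

lemma L2_ext_index_le_1_imp_mean:
  fixes A :: "complex^'n::{finite,linorder}^'n::{finite,linorder}"
  assumes A: "unitary_matrix A" and rs: "0 < r" "0 < s"
    and \<phi>: "continuous_on ((+) a ` biball q r s A) \<phi>"
    and h: "holomorphic_Cn_on h UNIV" "h 0 = 0"
    and G: "set_integrable lborel (biball q r s A) G"
      "\<And>v. v \<in> biball q r s A \<Longrightarrow> exp (\<phi> (a + v) - \<phi> a - Re (h v)) \<le> G v"
    and le: "L2_ext_index q \<phi> a r s A \<le> 1"
  shows "measure lborel (biball q r s A) \<le> set_lebesgue_integral lborel (biball q r s A) G"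
proof (rule ccontr)
  define P where "P = biball q r s A"
  define V where "V = measure lborel P"
  define c where "c = (2 * V - set_lebesgue_integral lborel P G) / V"
  have P: "open P" "bounded P" "0 \<in> P" "\<And>z c. z \<in> P \<Longrightarrow> cmod c \<le> 1 \<Longrightarrow> c *s z \<in> P"
    unfolding P_def using biball_props[OF A] rs by blast+
  have V: "V > 0" unfolding V_def using P by (intro measure_open_pos) auto
  have eV: "emeasure lborel P = ennreal V"
    unfolding V_def using emeasure_bounded_finite[OF P(2)]
    by (intro emeasure_eq_ennreal_measure) auto
  assume "\<not> ?thesis"
  hence c: "c > 1" using V by (simp add: c_def P_def[symmetric] V_def[symmetric])
  have "ennreal c \<le> L2_ext_index q \<phi> a r s A"
    unfolding L2_ext_index_def L2_ext_index_at_def P_def[symmetric]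
  proof (rule Inf_greatest, clarify)
    fix \<sigma> assume \<sigma>: "holomorphic_Cn_on \<sigma> ((+) a ` P)" "weighted_L2 \<phi> ((+) a ` P) \<sigma> < \<infinity>" "\<sigma> a = 1"
    have *: "weighted_L2 \<phi> ((+) a ` P) \<sigma> \<ge> ennreal (exp (- \<phi> a) * (c * V))"
      using weighted_L2_lower_bound[OF P \<phi>[folded P_def] h G[folded P_def] \<sigma>(1,3,2)] V
      by (simp add: c_def V_def)
    have "ennreal c = ennreal (exp (- \<phi> a) * (c * V)) / ennreal (V * exp (- \<phi> a))"
      using V c by (subst divide_ennreal) auto
    also have "\<dots> \<le> weighted_L2 \<phi> ((+) a ` P) \<sigma> / ennreal (V * exp (- \<phi> a))"
      using * by (rule divide_right_mono_ennreal)
    finally show "ennreal c \<le> weighted_L2 \<phi> ((+) a ` P) \<sigma> /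
        (emeasure lborel P * ennreal ((cmod 1)\<^sup>2 * exp (- \<phi> a)))"
      using V by (simp add: eV ennreal_mult)
  qed
  from order_trans[OF this le] have "ennreal c \<le> 1" .
  hence "c \<le> 1" by (simp add: ennreal_le_1)
  with c show False by simp
qed

section \<open>Second moments of bi-balls\<close>

definition moment :: "'n::finite set \<Rightarrow> real \<Rightarrow> real \<Rightarrow> 'n \<Rightarrow> real" where
  "moment I r s i = set_lebesgue_integral lborel (coord_biball I r s) (\<lambda>z. (cmod (z $ i))\<^sup>2)"

lemma moment_integrable:
  "set_integrable lborel (coord_biball I r s) (\<lambda>z::complex^'n. (cmod (z $ i))\<^sup>2)"
  by (intro set_integrable_continuous_bounded continuous_intros bounded_coord_biball
        borel_open open_coord_biball)

lemma integral_lborel_orthogonal: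
  fixes F :: "'a::euclidean_space \<Rightarrow> real" and f :: "'a \<Rightarrow> 'a"
  assumes f: "orthogonal_transformation f" and F: "F \<in> borel_measurable borel"
  shows "(\<integral>x. F (f x) \<partial>lborel) = (\<integral>x. F x \<partial>lborel)"
proof -
  have "f \<in> borel_measurable borel"
    using orthogonal_transformation_linear[OF f]
    by (intro borel_measurable_continuous_onI)
       (simp add: linear_continuous_on linear_conv_bounded_linear)
  hence "(\<integral>x. F x \<partial>distr lborel borel f) = (\<integral>x. F (f x) \<partial>lborel)"
    using F by (intro integral_distr) auto
  thus ?thesis unfolding lborel_distr_orthogonal_transformation[OF f] by simp
qed

lemma indicator_continuous_measurable:
  fixes F :: "'a::euclidean_space \<Rightarrow> real"
  assumes "continuous_on UNIV F" "open P"
  shows "(\<lambda>z. indicator P z *\<^sub>R F z) \<in> borel_measurable borel"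
  using assms by (intro borel_measurable_continuous_on_indicator) (auto intro: continuous_on_subset)

lemma L2_set_permute:
  assumes "p ` X = X" "inj_on p X"
  shows "L2_set (\<lambda>k. f (p k)) X = L2_set f X"
  unfolding L2_set_def using sum.reindex[OF assms(2), of "\<lambda>k. (f k)\<^sup>2"] assms(1) by simp

text \<open>
  Exchanging two coordinates of the same block is an isometry that preserves the bi-ball.
\<close>

lemma moment_swap:
  fixes i j :: "'n::finite"
  assumes "i \<in> I \<longleftrightarrow> j \<in> I"
  shows "moment I r s i = moment I r s j"
proof -
  define p where "p = Transposition.transpose i j"
  define f where "f z = (\<chi> k. z $ p k)" for z :: "complex^'n"
  have p: "bij p" by (simp add: p_def)
  have pI: "p ` I = I" "p ` (- I) = - I"
    using assms by (auto simp: p_def transpose_image_eq)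
  have inj: "inj_on p X" for X using p bij_is_inj inj_on_subset by blast
  have "norm (f z) = norm z" for z
    unfolding norm_vec_def f_def using L2_set_permute[of p UNIV "\<lambda>k. norm (z $ k)"] p inj
    by (simp add: bij_is_surj)
  moreover have "linear f" by (intro linearI) (simp_all add: f_def vec_eq_iff)
  ultimately have f: "orthogonal_transformation f" by (simp add: orthogonal_transformation)
  have mem: "f z \<in> coord_biball I r s \<longleftrightarrow> z \<in> coord_biball I r s" for z
    unfolding coord_biball_def f_def
    using L2_set_permute[OF pI(1) inj, of "\<lambda>k. cmod (z $ k)"]
          L2_set_permute[OF pI(2) inj, of "\<lambda>k. cmod (z $ k)"] by simp
  define F where "F z = indicator (coord_biball I r s) z *\<^sub>R (cmod (z $ i))\<^sup>2" for z :: "complex^'n"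
  have Fm: "F \<in> borel_measurable borel"
    unfolding F_def by (intro indicator_continuous_measurable continuous_intros open_coord_biball)
  have "moment I r s i = integral\<^sup>L lborel F"
    by (simp add: moment_def set_lebesgue_integral_def F_def[abs_def])
  also have "\<dots> = (\<integral>z. F (f z) \<partial>lborel)" by (rule integral_lborel_orthogonal[OF f Fm, symmetric])
  also have "\<dots> = moment I r s j"
    unfolding moment_def set_lebesgue_integral_def
    by (intro Bochner_Integration.integral_cong refl)
       (simp add: F_def mem indicator_def, simp add: f_def p_def)
  finally show ?thesis .
qed

lemma moment_pos:
  fixes i :: "'n::finite"
  assumes rs: "0 < r" "0 < s"
  shows "moment I r s i > 0"
proof -
  define P :: "(complex^'n) set" where "P = coord_biball I r s"
  have P: "open P" "bounded P" unfolding P_def by (rule open_coord_biball bounded_coord_biball)+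
  define F where "F z = indicator P z *\<^sub>R (cmod (z $ i))\<^sup>2" for z :: "complex^'n"
  have Fi: "integrable lborel F"
    using moment_integrable[of I r s i] unfolding set_integrable_def F_def[abs_def] P_def .
  have M: "moment I r s i = integral\<^sup>L lborel F"
    by (simp add: moment_def set_lebesgue_integral_def F_def[abs_def] P_def)
  have "integral\<^sup>L lborel F \<ge> 0" by (intro Bochner_Integration.integral_nonneg) (simp add: F_def)
  moreover have "integral\<^sup>L lborel F \<noteq> 0"
  proof
    assume "integral\<^sup>L lborel F = 0"
    hence ae: "AE z in lborel. F z = 0"
      using integral_nonneg_eq_0_iff_AE[OF Fi] by (simp add: F_def)
    define U where "U = P \<inter> {z. z $ i \<noteq> 0}"
    have U: "open U" "bounded U"
      unfolding U_def using P
      by (auto intro!: open_Int open_Collect_neq continuous_intros intro: bounded_subset)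
    define w :: "complex^'n" where "w = axis i (of_real (min r s / 2))"
    have wb: "L2_set (\<lambda>k. cmod (w $ k)) X \<le> min r s / 2" for X
    proof -
      have "L2_set (\<lambda>k. cmod (w $ k)) X \<le> (\<Sum>k\<in>X. cmod (w $ k))"
        by (rule L2_set_le_sum) simp
      also have "\<dots> \<le> (\<Sum>k\<in>UNIV. cmod (w $ k))" by (rule sum_mono2) auto
      also have "\<dots> = (\<Sum>k\<in>UNIV. if k = i then min r s / 2 else 0)"
        using rs by (intro sum.cong refl) (auto simp: w_def axis_def)
      finally show ?thesis by simp
    qed
    have "w \<in> P" using rs wb[of I] wb[of "- I"] unfolding P_def coord_biball_def by auto
    hence "U \<noteq> {}" using rs unfolding U_def by (auto simp: w_def axis_def)
    hence pos: "measure lborel U > 0" using U by (intro measure_open_pos)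
    have "AE z in lborel. z \<notin> U" using ae by eventually_elim (auto simp: U_def F_def)
    hence "U \<in> null_sets lborel"
      using U(1) by (subst AE_iff_null_sets) auto
    hence "measure lborel U = 0" by (rule measure_eq_0_null_sets)
    thus False using pos by simp
  qed
  ultimately show ?thesis unfolding M by simp
qed

text \<open>
  The constant \<open>C\<close> is the Jacobian of the block scaling that maps the unit bi-ball onto this one.  It
  does not depend on \<open>i\<close>, which is all that matters: a common factor drops out of sign conditions.
\<close>

lemma moment_scale:
  fixes I :: "'n::finite set"
  assumes rs: "0 < r" "0 < s"
  obtains C where "C > 0"
    "\<And>i. moment I r s i = C * (if i \<in> I then r else s)\<^sup>2 * moment I 1 1 i"
proof -
  define t where "t i = (if i \<in> I then r else s)" for i
  have t: "t i > 0" for i using rs by (simp add: t_def)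
  define T where "T z = (\<chi> i. t i *\<^sub>R z $ i)" for z :: "complex^'n"
  have Tlin: "linear T" by (intro linearI) (simp_all add: T_def vec_eq_iff algebra_simps)
  define c where "c b = T b \<bullet> b" for b
  have Tb: "T b = c b *\<^sub>R b \<and> c b > 0" if "b \<in> Basis" for b
  proof -
    obtain i u where b: "b = axis i u" "u \<in> Basis"
      using \<open>b \<in> Basis\<close> by (auto simp: Basis_vec_def)
    have T: "T b = t i *\<^sub>R b" unfolding b T_def by (auto simp: vec_eq_iff axis_def)
    have "c b = t i" unfolding c_def T using that by (simp add: inner_Basis)
    thus ?thesis using T t by simp
  qed
  have T_eq: "T = (\<lambda>x. 0 + (\<Sum>j\<in>Basis. (c j * (x \<bullet> j)) *\<^sub>R j))"
  proof
    fix x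
    have "T x = T (\<Sum>j\<in>Basis. (x \<bullet> j) *\<^sub>R j)" by (simp add: euclidean_representation)
    also have "\<dots> = (\<Sum>j\<in>Basis. (x \<bullet> j) *\<^sub>R T j)"
      by (simp add: linear_sum[OF Tlin] linear_scale[OF Tlin])
    also have "\<dots> = (\<Sum>j\<in>Basis. (c j * (x \<bullet> j)) *\<^sub>R j)"
      using Tb by (intro sum.cong refl) (simp add: mult.commute)
    finally show "T x = 0 + (\<Sum>j\<in>Basis. (c j * (x \<bullet> j)) *\<^sub>R j)" by simp
  qed
  define C where "C = (\<Prod>j\<in>Basis. \<bar>c j\<bar>)"
  have "C > 0" unfolding C_def using Tb by (intro prod_pos) force
  have dens: "lborel = density (distr lborel borel T) (\<lambda>_. ennreal C)"
    unfolding T_eq C_def using Tb by (intro lborel_affine_euclidean) force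
  have Tm: "T \<in> borel_measurable borel"
    using Tlin by (intro borel_measurable_continuous_onI)
       (simp add: linear_continuous_on linear_conv_bounded_linear)
  have scale: "L2_set (\<lambda>i. cmod (T z $ i)) X = k * L2_set (\<lambda>i. cmod (z $ i)) X"
    if "\<And>i. i \<in> X \<Longrightarrow> t i = k" "k > 0" for z X k
  proof -
    have "L2_set (\<lambda>i. cmod (T z $ i)) X = L2_set (\<lambda>i. k * cmod (z $ i)) X"
      using that by (intro L2_set_cong) (auto simp: T_def)
    thus ?thesis using that(2) by (simp add: L2_set_right_distrib)
  qed
  have mem: "T z \<in> coord_biball I r s \<longleftrightarrow> z \<in> coord_biball I 1 1" for z
    unfolding coord_biball_def using scale[of I r z] scale[of "- I" s z] rs by (simp add: t_def)
  have "moment I r s i = C * (t i)\<^sup>2 * moment I 1 1 i" for i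
  proof -
    define F where "F z = indicator (coord_biball I r s) z *\<^sub>R (cmod (z $ i))\<^sup>2" for z :: "complex^'n"
    have Fm: "F \<in> borel_measurable borel"
      unfolding F_def by (intro indicator_continuous_measurable continuous_intros open_coord_biball)
    have "moment I r s i = integral\<^sup>L lborel F"
      by (simp add: moment_def set_lebesgue_integral_def F_def[abs_def])
    also have "\<dots> = integral\<^sup>L (density (distr lborel borel T) (\<lambda>_. ennreal C)) F"
      by (subst dens) (rule refl)
    also have "\<dots> = (\<integral>z. C *\<^sub>R F z \<partial>distr lborel borel T)"
      using Fm \<open>C > 0\<close> by (intro integral_density) auto
    also have "\<dots> = (\<integral>z. C *\<^sub>R F (T z) \<partial>lborel)"
      using Fm Tm by (intro integral_distr) auto
    also have "\<dots> = (\<integral>z. (C * (t i)\<^sup>2) * (indicator (coord_biball I 1 1) z *\<^sub>R (cmod (z $ i))\<^sup>2) \<partial>lborel)"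
      by (intro Bochner_Integration.integral_cong refl)
         (simp add: F_def mem indicator_def, simp add: T_def power_mult_distrib)
    also have "\<dots> = C * (t i)\<^sup>2 * moment I 1 1 i"
      by (simp add: moment_def set_lebesgue_integral_def)
    finally show ?thesis .
  qed
  with \<open>C > 0\<close> that show thesis unfolding t_def by blast
qed

lemma biball_integral_quadratic:
  fixes A :: "complex^'n::{finite,linorder}^'n::{finite,linorder}"
  assumes A: "unitary_matrix A" and Q: "continuous_on UNIV Q"
    and diag: "\<And>z. Q (A *v z) = (\<Sum>i\<in>UNIV. e i * (cmod (z $ i))\<^sup>2)"
  shows "set_lebesgue_integral lborel (biball q r s A) Q
       = (\<Sum>i\<in>UNIV. e i * moment (first_coords q) r s i)"
proof -
  define P0 :: "(complex, 'n) vec set" where "P0 = coord_biball (first_coords q) r s"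
  define F where "F z = indicator (biball q r s A) z *\<^sub>R Q z" for z
  have ot: "orthogonal_transformation ((*v) A)"
    using A by (rule unitary_matrix_orthogonal_transformation)
  have mem: "A *v z \<in> biball q r s A \<longleftrightarrow> z \<in> P0" for z
    unfolding biball_eq P0_def using orthogonal_transformation_inj[OF ot] by (simp add: inj_image_mem_iff)
  have Fm: "F \<in> borel_measurable borel"
    unfolding F_def by (intro indicator_continuous_measurable Q biball_props[OF A])
  have "set_lebesgue_integral lborel (biball q r s A) Q = (\<integral>z. F (A *v z) \<partial>lborel)"
    unfolding set_lebesgue_integral_def integral_lborel_orthogonal[OF ot Fm] by (simp add: F_def[abs_def])
  also have "\<dots> = (\<integral>z. (\<Sum>i\<in>UNIV. e i * (indicator P0 z *\<^sub>R (cmod (z $ i))\<^sup>2)) \<partial>lborel)"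
    by (intro Bochner_Integration.integral_cong refl)
       (simp add: F_def mem indicator_def diag)
  also have "\<dots> = (\<Sum>i\<in>UNIV. e i * moment (first_coords q) r s i)"
    using moment_integrable[of "first_coords q" r s] unfolding set_integrable_def moment_def set_lebesgue_integral_def P0_def
    by (subst Bochner_Integration.integral_sum) auto
  finally show ?thesis .
qed

section \<open>Nonnegativity of eigenvalue sums\<close>

lemma exp_le_quadratic:
  fixes x :: real
  assumes "x \<le> 1"
  shows "exp x \<le> 1 + x + x\<^sup>2"
proof (cases "x \<ge> 0")
  case True
  then show ?thesis using assms by (rule exp_bound)
next
  case False
  have "(1 - x) * exp x \<le> exp (- x) * exp x"
    using exp_ge_add_one_self[of "- x"] by (intro mult_right_mono) auto
  also have "\<dots> = 1" by (simp add: exp_minus)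
  also have "1 \<le> (1 - x) * (1 + x + x\<^sup>2)"
  proof -
    have "(1 - x) * (1 + x + x\<^sup>2) = 1 - x * x\<^sup>2" by (simp add: algebra_simps power2_eq_square)
    moreover have "x * x\<^sup>2 \<le> 0" using False by (intro mult_nonpos_nonneg) auto
    ultimately show ?thesis by simp
  qed
  finally show ?thesis using False by simp
qed

lemma nonneg_of_arbitrarily_small_perturbation:
  fixes x y :: real
  assumes "\<And>s. s > 0 \<Longrightarrow> 0 \<le> x + s * y"
  shows "0 \<le> x"
proof (rule ccontr)
  assume "\<not> 0 \<le> x"
  hence "x < 0" by simp
  define s where "s = - x / (2 * (\<bar>y\<bar> + 1))"
  have s: "s > 0" using \<open>x < 0\<close> by (simp add: s_def divide_neg_pos add_pos_nonneg zero_less_divide_iff)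
  have "s * y \<le> s * (\<bar>y\<bar> + 1)" using s by (intro mult_left_mono) auto
  also have "\<dots> = - x / 2" by (simp add: s_def field_simps add_nonneg_eq_0_iff)
  finally show False using assms[OF s] \<open>x < 0\<close> by simp
qed

text \<open>
  The bi-ball of radii \<open>l r\<close>, \<open>l s\<close> has the shape prescribed by \<open>r\<close> and \<open>s\<close>, and for small \<open>l\<close> it fits
  into the region where the Taylor remainder is at most \<open>\<epsilon> |v|\<^sup>2\<close>.  There the index bound makes the
  mean of \<open>S(v) + 2 \<epsilon> |v|\<^sup>2\<close> nonnegative.  By homogeneity this condition depends on \<open>r\<close> and \<open>s\<close> but no
  longer on \<open>l\<close>, so that \<open>\<epsilon>\<close> may tend to \<open>0\<close>.
\<close>

lemma weighted_eigenvalue_sum_nonneg: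
  fixes \<Omega> :: "(complex ^ 'n::{finite,linorder}) set"
    and A :: "complex^'n::{finite,linorder}^'n::{finite,linorder}"
  assumes \<Omega>: "open \<Omega>" "a \<in> \<Omega>" and C2: "Ck_on 2 \<phi> \<Omega>" and A: "unitary_matrix A"
    and diag: "\<And>z. (\<Sum>j\<in>UNIV. \<Sum>k\<in>UNIV. complex_hessian \<phi> a $ j $ k * (A *v z) $ j * cnj ((A *v z) $ k))
            = of_real (\<Sum>i\<in>UNIV. d i * (cmod (z $ i))\<^sup>2)"
    and index: "\<And>r s. \<lbrakk>0 < r; 0 < s; (+) a ` biball q r s A \<subseteq> \<Omega>\<rbrakk>
           \<Longrightarrow> L2_ext_index q \<phi> a r s A \<le> 1"
    and rs: "0 < r" "0 < s"
  shows "0 \<le> (\<Sum>i\<in>UNIV. d i * ((if i \<in> first_coords q then r else s)\<^sup>2 * moment (first_coords q) 1 1 i))"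
proof -
  define I :: "'n set" where "I = first_coords q"
  define H where "H = complex_hessian \<phi> a"
  define S where "S v = Re (\<Sum>j\<in>UNIV. \<Sum>k\<in>UNIV. H $ j $ k * v $ j * cnj (v $ k))" for v
  define w where "w i = (if i \<in> I then r else s)\<^sup>2 * moment I 1 1 i" for i
  have ot: "orthogonal_transformation ((*v) A)"
    using A by (rule unitary_matrix_orthogonal_transformation)
  have S_diag: "S (A *v z) = (\<Sum>i\<in>UNIV. d i * (cmod (z $ i))\<^sup>2)" for z
    unfolding S_def H_def diag by simp
  have norm_sq: "(norm z)\<^sup>2 = (\<Sum>i\<in>UNIV. (cmod (z $ i))\<^sup>2)" for z :: "(complex, 'n) vec"
    by (simp add: norm_vec_def L2_set_def sum_nonneg)
  define K where "K = (\<Sum>i\<in>UNIV. \<bar>d i\<bar>)"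
  have K: "K \<ge> 0" by (simp add: K_def sum_nonneg)
  have S_bound: "\<bar>S v\<bar> \<le> K * (norm v)\<^sup>2" for v
  proof -
    obtain z where z: "v = A *v z" using orthogonal_transformation_surj[OF ot] by (metis surjD)
    have "\<bar>S v\<bar> \<le> (\<Sum>i\<in>UNIV. \<bar>d i * (cmod (z $ i))\<^sup>2\<bar>)" unfolding z S_diag by (rule sum_abs)
    also have "\<dots> \<le> (\<Sum>i\<in>UNIV. \<bar>d i\<bar> * (norm z)\<^sup>2)"
      by (intro sum_mono) (auto simp: abs_mult intro!: mult_left_mono power_mono component_le_norm_cart Finite_Cartesian_Product.norm_nth_le)
    also have "\<dots> = K * (norm v)\<^sup>2"
      unfolding z orthogonal_transformation_norm[OF ot] K_def by (simp add: sum_distrib_right)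
    finally show ?thesis .
  qed
  have S_cont: "continuous_on UNIV S" unfolding S_def by (intro continuous_intros)
  obtain h where h: "holomorphic_Cn_on h UNIV" "h 0 = 0"
    and taylor: "\<And>\<epsilon>. \<epsilon> > 0 \<Longrightarrow> \<exists>\<delta>>0. \<forall>v. norm v < \<delta> \<longrightarrow> a + v \<in> \<Omega> \<and>
        \<bar>\<phi> (a + v) - \<phi> a - Re (h v) - S v\<bar> \<le> \<epsilon> * (norm v)\<^sup>2"
    using levi_expansion(2)[OF \<Omega> C2] unfolding S_def H_def by blast
  have \<phi>c: "continuous_on \<Omega> \<phi>"
    by (intro continuous_at_imp_continuous_on ballI)
       (use C2_on_has_derivatives(1)[OF C2] has_derivative_continuous in blast)
  have pert: "0 \<le> (\<Sum>i\<in>UNIV. d i * w i) + \<epsilon> * (\<Sum>i\<in>UNIV. 2 * w i)" if \<epsilon>: "\<epsilon> > 0" for \<epsilon>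
  proof -
    obtain \<delta> where "\<delta> > 0" and \<delta>: "\<And>v. norm v < \<delta> \<Longrightarrow> a + v \<in> \<Omega> \<and>
        \<bar>\<phi> (a + v) - \<phi> a - Re (h v) - S v\<bar> \<le> \<epsilon> * (norm v)\<^sup>2"
      using taylor[OF \<epsilon>] by blast
    \<comment> \<open>Together with \<open>|v| < 1\<close>, the last two bounds give \<open>|x| \<le> 1\<close> and \<open>x\<^sup>2 \<le> \<epsilon> |v|\<^sup>2\<close> for the
      exponent \<open>x\<close> below, as needed to replace \<open>exp x\<close> by its quadratic bound.\<close>
    define \<eta> where "\<eta> = min 1 (min \<delta> (min (1 / (K + \<epsilon>)) (\<epsilon> / (K + \<epsilon>)\<^sup>2)))"
    have \<eta>: "\<eta> > 0" using \<epsilon> K \<open>\<delta> > 0\<close> by (simp add: \<eta>_def add_nonneg_pos)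
    define l where "l = \<eta> / (r + s)"
    have "l * r + l * s = l * (r + s)" by (simp add: distrib_left)
    hence l: "l > 0" "l * r + l * s = \<eta>" using \<eta> rs by (auto simp: l_def)
    define P where "P = biball q (l * r) (l * s) A"
    have Pn: "norm v < \<eta>" if "v \<in> P" for v
      using biball_props(5)[OF A that[unfolded P_def]] l by simp
    have P\<Omega>: "(+) a ` P \<subseteq> \<Omega>" using Pn \<delta> by (force simp: \<eta>_def)
    define G where "G v = 1 + (S v + (2 * \<epsilon>) * (norm v)\<^sup>2)" for v
    have G: "exp (\<phi> (a + v) - \<phi> a - Re (h v)) \<le> G v" if "v \<in> P" for v
    proof -
      define x where "x = \<phi> (a + v) - \<phi> a - Re (h v)"
      define n where "n = (norm v)\<^sup>2"
      have v: "norm v < 1" "norm v < \<delta>" "norm v < 1 / (K + \<epsilon>)" "norm v < \<epsilon> / (K + \<epsilon>)\<^sup>2"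
        using Pn[OF that] by (auto simp: \<eta>_def)
      have n: "n \<ge> 0" "n \<le> norm v"
        using v(1) by (auto simp: n_def power2_eq_square mult_left_le)
      have x: "\<bar>x - S v\<bar> \<le> \<epsilon> * n" unfolding x_def n_def using \<delta>[OF v(2)] by blast
      have xK: "\<bar>x\<bar> \<le> (K + \<epsilon>) * n" using x S_bound[of v] unfolding n_def[symmetric] by (simp add: algebra_simps)
      have K\<epsilon>: "K + \<epsilon> > 0" using K \<epsilon> by simp
      have "n < 1 / (K + \<epsilon>)" "n < \<epsilon> / (K + \<epsilon>)\<^sup>2" using n v by linarith+
      hence n1: "(K + \<epsilon>) * n < 1" and n2: "(K + \<epsilon>)\<^sup>2 * n < \<epsilon>"
        using K\<epsilon> by (auto simp: field_simps)
      have "x \<le> 1" using xK n1 by linarith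
      hence "exp x \<le> 1 + x + x\<^sup>2" by (rule exp_le_quadratic)
      also have "x\<^sup>2 \<le> ((K + \<epsilon>) * n)\<^sup>2" using xK by (rule abs_le_square_iff[THEN iffD1, OF order_trans]) (use xK in linarith)
      also have "((K + \<epsilon>) * n)\<^sup>2 = ((K + \<epsilon>)\<^sup>2 * n) * n" by (simp add: power2_eq_square)
      also have "\<dots> \<le> \<epsilon> * n" using n n2 by (intro mult_right_mono) auto
      finally show ?thesis unfolding G_def x_def[symmetric] n_def[symmetric] using x by simp
    qed
    have Q: "continuous_on UNIV (\<lambda>v. S v + (2 * \<epsilon>) * (norm v)\<^sup>2)"
      by (intro continuous_intros S_cont)
    have Pprops: "open P" "bounded P" unfolding P_def using biball_props[OF A] by blast+
    have Gi: "set_integrable lborel P G"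
      unfolding G_def using Pprops by (intro set_integrable_continuous_bounded continuous_intros S_cont) auto
    have Qi: "set_integrable lborel P (\<lambda>v. S v + (2 * \<epsilon>) * (norm v)\<^sup>2)"
      using Pprops by (intro set_integrable_continuous_bounded Q) auto
    have 1: "set_integrable lborel P (\<lambda>v. 1::real)"
      using Pprops by (intro set_integrable_continuous_bounded continuous_intros) auto
    have "measure lborel P \<le> set_lebesgue_integral lborel P G"
      unfolding P_def
    proof (rule L2_ext_index_le_1_imp_mean[OF A _ _ _ h])
      show "0 < l * r" "0 < l * s" using l rs by auto
      thus "L2_ext_index q \<phi> a (l * r) (l * s) A \<le> 1"
        using P\<Omega> by (intro index) (auto simp: P_def)
      show "continuous_on ((+) a ` biball q (l * r) (l * s) A) \<phi>"
        using \<phi>c P\<Omega> unfolding P_def by (rule continuous_on_subset)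
    qed (use G Gi in \<open>auto simp: P_def\<close>)
    also have "\<dots> = measure lborel P + set_lebesgue_integral lborel P (\<lambda>v. S v + (2 * \<epsilon>) * (norm v)\<^sup>2)"
      unfolding G_def using set_integral_add(2)[OF 1 Qi] Pprops emeasure_bounded_finite[of P]
      by (simp add: set_integral_const)
    finally have "0 \<le> set_lebesgue_integral lborel P (\<lambda>v. S v + (2 * \<epsilon>) * (norm v)\<^sup>2)" by simp
    also have "\<dots> = (\<Sum>i\<in>UNIV. (d i + 2 * \<epsilon>) * moment I (l * r) (l * s) i)"
      unfolding P_def I_def
      by (rule biball_integral_quadratic[OF A Q])
         (simp add: S_diag orthogonal_transformation_norm[OF ot] norm_sq sum_distrib_left sum.distrib algebra_simps)
    finally have nn: "0 \<le> (\<Sum>i\<in>UNIV. (d i + 2 * \<epsilon>) * moment I (l * r) (l * s) i)" .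
    obtain C where "C > 0" and C: "\<And>i. moment I (l * r) (l * s) i
        = C * (if i \<in> I then l * r else l * s)\<^sup>2 * moment I 1 1 i"
      using moment_scale[of "l * r" "l * s" I] l rs by auto
    have "moment I (l * r) (l * s) i = (C * l\<^sup>2) * w i" for i
      unfolding C w_def by (simp add: power_mult_distrib)
    hence "(\<Sum>i\<in>UNIV. (d i + 2 * \<epsilon>) * moment I (l * r) (l * s) i)
        = (C * l\<^sup>2) * (\<Sum>i\<in>UNIV. (d i + 2 * \<epsilon>) * w i)"
      by (simp add: sum_distrib_left mult_ac)
    with nn have "0 \<le> (C * l\<^sup>2) * (\<Sum>i\<in>UNIV. (d i + 2 * \<epsilon>) * w i)" by simp
    moreover have "0 < C * l\<^sup>2" using \<open>C > 0\<close> l by simp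
    ultimately have "0 \<le> (\<Sum>i\<in>UNIV. (d i + 2 * \<epsilon>) * w i)"
      by (metis mult_le_cancel_left_pos mult_zero_right)
    thus ?thesis by (simp add: sum.distrib sum_distrib_left algebra_simps)
  qed
  have "0 \<le> (\<Sum>i\<in>UNIV. d i * w i)"
    using pert by (rule nonneg_of_arbitrarily_small_perturbation)
  thus ?thesis unfolding w_def I_def .
qed

text \<open>
  Within a block the moments agree, so the hypothesis is \<open>r\<^sup>2 \<kappa> \<Sigma> + s\<^sup>2 \<kappa>' \<Sigma>' \<ge> 0\<close> with the two
  block sums \<open>\<Sigma>\<close> and \<open>\<Sigma>'\<close>.  Letting one radius tend to \<open>0\<close> isolates the block sum of the other.
\<close>

lemma block_sums_nonneg:
  fixes I :: "'n::finite set" and d :: "'n \<Rightarrow> real"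
  assumes "\<And>r s. 0 < r \<Longrightarrow> 0 < s \<Longrightarrow>
      0 \<le> (\<Sum>i\<in>UNIV. d i * ((if i \<in> I then r else s)\<^sup>2 * moment I 1 1 i))"
  shows "0 \<le> (\<Sum>i\<in>I. d i)" "0 \<le> (\<Sum>i\<in>-I. d i)"
proof -
  have block: "\<exists>m>0. (\<Sum>i\<in>X. d i * moment I 1 1 i) = m * (\<Sum>i\<in>X. d i)"
    if X: "X = I \<or> X = - I" for X
  proof (cases "X = {}")
    case False
    then obtain j where j: "j \<in> X" by blast
    have "moment I 1 1 i = moment I 1 1 j" if "i \<in> X" for i
      using X j that by (intro moment_swap) auto
    hence "(\<Sum>i\<in>X. d i * moment I 1 1 i) = moment I 1 1 j * (\<Sum>i\<in>X. d i)"
      by (simp add: sum_distrib_right[symmetric] mult.commute)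
    thus ?thesis using moment_pos[of 1 1 I j] by auto
  qed (auto intro: exI[of _ 1])
  obtain m where m: "m > 0" "(\<Sum>i\<in>I. d i * moment I 1 1 i) = m * (\<Sum>i\<in>I. d i)"
    using block by blast
  obtain m' where m': "m' > 0" "(\<Sum>i\<in>-I. d i * moment I 1 1 i) = m' * (\<Sum>i\<in>-I. d i)"
    using block by blast
  have split: "0 \<le> r\<^sup>2 * (m * (\<Sum>i\<in>I. d i)) + s\<^sup>2 * (m' * (\<Sum>i\<in>-I. d i))" if "0 < r" "0 < s" for r s
  proof -
    have "(\<Sum>i\<in>UNIV. d i * ((if i \<in> I then r else s)\<^sup>2 * moment I 1 1 i))
       = (\<Sum>i\<in>I. d i * ((if i \<in> I then r else s)\<^sup>2 * moment I 1 1 i))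
       + (\<Sum>i\<in>-I. d i * ((if i \<in> I then r else s)\<^sup>2 * moment I 1 1 i))"
      by (subst sum.union_disjoint[symmetric]) (auto simp: Compl_partition)
    also have "(\<Sum>i\<in>I. d i * ((if i \<in> I then r else s)\<^sup>2 * moment I 1 1 i)) = r\<^sup>2 * (m * (\<Sum>i\<in>I. d i))"
      unfolding m(2)[symmetric] by (simp add: sum_distrib_left mult_ac)
    also have "(\<Sum>i\<in>-I. d i * ((if i \<in> I then r else s)\<^sup>2 * moment I 1 1 i)) = s\<^sup>2 * (m' * (\<Sum>i\<in>-I. d i))"
      unfolding m'(2)[symmetric] by (simp add: sum_distrib_left mult_ac)
    finally show ?thesis using assms[OF that] by simp
  qed
  have "0 \<le> m * (\<Sum>i\<in>I. d i)"
  proof (rule nonneg_of_arbitrarily_small_perturbation)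
    fix s :: real assume "s > 0"
    show "0 \<le> m * (\<Sum>i\<in>I. d i) + s * (m' * (\<Sum>i\<in>-I. d i))"
      using split[of 1 "sqrt s"] \<open>s > 0\<close> by simp
  qed
  thus "0 \<le> (\<Sum>i\<in>I. d i)" using m(1) by (simp add: zero_le_mult_iff)
  have "0 \<le> m' * (\<Sum>i\<in>-I. d i)"
  proof (rule nonneg_of_arbitrarily_small_perturbation)
    fix s :: real assume "s > 0"
    show "0 \<le> m' * (\<Sum>i\<in>-I. d i) + s * (m * (\<Sum>i\<in>I. d i))"
      using split[of "sqrt s" 1] \<open>s > 0\<close> by simp
  qed
  thus "0 \<le> (\<Sum>i\<in>-I. d i)" using m'(1) by (simp add: zero_le_mult_iff)
qed

lemma sub_multiset_of_image_mset_set: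
  assumes "finite X" "M \<subseteq># image_mset f (mset_set X)"
  obtains J where "J \<subseteq> X" "M = image_mset f (mset_set J)"
proof -
  obtain R where "image_mset f (mset_set X) = M + R" using assms(2) by (metis subset_mset.add_diff_inverse)
  then obtain N R' where N: "mset_set X = N + R'" "M = image_mset f N"
    using image_mset_eq_plusD by metis
  have "N \<subseteq># mset_set X" using N(1) by simp
  hence "N = mset_set (set_mset N)"
  proof -
    have le1: "count N x \<le> 1" for x
      using mset_subset_eq_count[OF \<open>N \<subseteq># mset_set X\<close>, of x] by (auto simp: count_mset_set' split: if_splits)
    have "count N x = (if x \<in># N then 1 else 0)" for x
      by (metis One_nat_def Suc_leI count_greater_zero_iff le1 le_antisym not_in_iff)
    hence "count N x = count (mset_set (set_mset N)) x" for x
      by (simp add: count_mset_set')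
    thus ?thesis by (rule multiset_eqI)
  qed
  moreover have "set_mset N \<subseteq> X"
    using set_mset_mono[OF \<open>N \<subseteq># mset_set X\<close>] assms(1) by simp
  ultimately show thesis using that N(2) by metis
qed

lemma bij_with_image:
  fixes K J :: "'a::finite set"
  assumes "card K = card J"
  obtains p where "bij p" "p ` K = J"
proof -
  obtain f where f: "bij_betw f K J" using assms finite_same_card_bij[of K J] by auto
  have "card (- K) = card (- J)" using assms by (simp add: Compl_eq_Diff_UNIV card_Diff_subset)
  then obtain g where g: "bij_betw g (- K) (- J)" using finite_same_card_bij[of "- K" "- J"] by auto
  define p where "p x = (if x \<in> K then f x else g x)" for x
  have pf: "bij_betw p K J" using f by (subst bij_betw_cong[of K p f]) (auto simp: p_def)
  have pg: "bij_betw p (- K) (- J)" using g by (subst bij_betw_cong[of "- K" p g]) (auto simp: p_def)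
  have "bij_betw p (K \<union> - K) (J \<union> - J)" by (rule bij_betw_combine[OF pf pg]) auto
  hence "bij p" by (simp add: Compl_partition)
  thus thesis using that pf by (auto simp: bij_betw_def)
qed

theorem theorem3p6:
  fixes \<Omega> :: "(complex ^ 'n::{finite,linorder}) set"
    and \<phi> :: "complex ^ 'n::{finite,linorder} \<Rightarrow> real"
    and q :: nat
  assumes "CARD('n) \<ge> 2"
    and "open \<Omega>" and "connected \<Omega>" and "\<Omega> \<noteq> {}"
    and "smooth_on \<phi> \<Omega>"
    and "1 \<le> q" and "q \<le> CARD('n)"
    and "\<And>a r s A. \<lbrakk>a \<in> \<Omega>; 0 < r; 0 < s; unitary_matrix A; (+) a ` biball q r s A \<subseteq> \<Omega>\<rbrakk>
           \<Longrightarrow> L2_ext_index q \<phi> a r s A \<le> 1"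
  shows "uniformly_semipositive_on
           ((if q = CARD('n) then CARD('n) else min q (CARD('n) - q)) - 1) \<phi> \<Omega>"
  unfolding uniformly_semipositive_on_def
proof (intro ballI allI impI, elim conjE)
  fix a M
  assume a: "a \<in> \<Omega>" and M: "M \<subseteq># eigenvalues (complex_hessian \<phi> a)"
    and size: "size M = (if q = CARD('n) then CARD('n) else min q (CARD('n) - q)) - 1 + 1"
  define I :: "'n set" where "I = first_coords q"
  have cI: "card I = q" "card (- I) = CARD('n) - q"
    using card_first_coords[OF assms(7)] by (simp_all add: I_def Compl_eq_Diff_UNIV card_Diff_subset)
  have C2: "Ck_on 2 \<phi> \<Omega>" using assms(5) by (simp add: smooth_on_def)
  obtain A and d :: "'n \<Rightarrow> real" where A: "unitary_matrix A"
    and diag: "\<And>z. (\<Sum>j\<in>UNIV. \<Sum>k\<in>UNIV. complex_hessian \<phi> a $ j $ k * (A *v z) $ j * cnj ((A *v z) $ k))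
            = of_real (\<Sum>i\<in>UNIV. d i * (cmod (z $ i))\<^sup>2)"
    and eig: "eigenvalues (complex_hessian \<phi> a) = image_mset (\<lambda>i. of_real (d i)) (mset_set UNIV)"
    using hermitian_diagonalization[of "complex_hessian \<phi> a"] levi_expansion(1)[OF assms(2) a C2] by blast
  obtain J where J: "M = image_mset (\<lambda>i. of_real (d i)) (mset_set J)"
    using sub_multiset_of_image_mset_set[OF _ M[unfolded eig]] by auto
  have "card J = size M" by (simp add: J)
  \<comment> \<open>Permuting the columns of \<open>A\<close> puts the chosen eigenvalues into a block \<open>K\<close> of the same size.\<close>
  hence "card J = card I \<or> card J = card (- I)"
    using size assms(6,7) unfolding cI by (auto simp: min_def split: if_splits)
  then obtain K where K: "K = I \<or> K = - I" "card K = card J" by metis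
  then obtain p where p: "bij p" "p ` K = J" using bij_with_image by blast
  define A' where "A' = (\<chi> i j. A $ i $ p j)"
  have A': "unitary_matrix A'" unfolding A'_def by (rule unitary_matrix_permute_columns[OF A p(1)])
  have diag': "(\<Sum>j\<in>UNIV. \<Sum>k\<in>UNIV. complex_hessian \<phi> a $ j $ k * (A' *v z) $ j * cnj ((A' *v z) $ k))
            = of_real (\<Sum>i\<in>UNIV. d (p i) * (cmod (z $ i))\<^sup>2)" for z
  proof -
    have "(\<Sum>i\<in>UNIV. d (p i) * (cmod (z $ inv p (p i)))\<^sup>2) = (\<Sum>i\<in>UNIV. d i * (cmod (z $ inv p i))\<^sup>2)"
      by (rule sum.reindex_bij_betw[OF p(1)])
    thus ?thesis
      unfolding A'_def matrix_vector_mult_permute_columns[OF p(1)] diag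
      by (simp only: inv_f_f[OF bij_is_inj[OF p(1)]] vec_lambda_beta)
  qed
  have "0 \<le> (\<Sum>i\<in>UNIV. d (p i) * ((if i \<in> I then r else s)\<^sup>2 * moment I 1 1 i))"
    if "0 < r" "0 < s" for r s
    unfolding I_def using assms(8)[OF a] A'
    by (intro weighted_eigenvalue_sum_nonneg[OF assms(2) a C2 A' diag'] that)
  hence "0 \<le> (\<Sum>i\<in>K. d (p i))" using K(1) block_sums_nonneg[of "\<lambda>i. d (p i)" I] by auto
  also have "\<dots> = (\<Sum>i\<in>J. d i)"
    unfolding p(2)[symmetric] using p(1) by (subst sum.reindex) (auto intro: inj_on_subset bij_is_inj)
  finally have "0 \<le> (\<Sum>i\<in>J. d i)" .
  moreover have "\<Sum>\<^sub># M = of_real (\<Sum>i\<in>J. d i)" unfolding J of_real_sum by (simp add: sum_unfold_sum_mset)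
  ultimately show "\<Sum>\<^sub># M \<in> \<real>\<^sub>\<ge>\<^sub>0"
    by (simp only: nonneg_Reals_of_real_iff)
qed

end
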